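(* Let $$V_k^\star=\begin{bmatrix}X_k^\star&R_k^\star\\(R_k^\star)^T&U_k^\star\end{bmatrix},\qquad k=0,\dots,N-1$$ (with $X_k^\star\in\mathbb{R}^{n\times n}$, $R_k^\star\in\mathbb{R}^{n\times m}$, $U_k^\star\in\mathbb{R}^{m\times m}$) be a solution to $$\min_{V_k\succeq0}\ \frac1N\sum_{k=0}^{N-1}\mathbf{Tr}\left(\begin{bmatrix}C&D\end{bmatrix}V_k\begin{bmatrix}C&D\end{bmatrix}^T\right)$$ subject to $FV_0F^T=0$, $$FV_{k+1}F^T=\begin{bmatrix}A&B\end{bmatrix}V_k\begin{bmatrix}A&B\end{bmatrix}^T+\sum_{i=1}^MA_iFV_kF^TA_i^T+I,\qquad k=0,\dots,N-2,$$ $$\gamma_j(k)\ge\mathbf{Tr}(Q_jV_k),\qquad j=1,\dots,J,\ k=0,\dots,N-1,$$ with $F=\begin{bmatrix}I_n&0\end{bmatrix}\in\mathbb{R}^{n\times(n+m)}$. Then an optimal solution to the constrained optimal control problem $$\min_{\mu_k}\ \frac1N\sum_{k=0}^{N-1}\mathbf{E}\{z_k^Tz_k\}$$ subject to $$x_{k+1}=\Big(A+\sum_{i=1}^M\sigma_k(i)A_i\Big)x_k+Bu_k+w_k,\quad x_0=0,\quad z_k=Cx_k+Du_k,\quad u_k=\mu_k(x_0,\dots,x_k),$$ $$\gamma_j(k)\ \ge\ \mathbf{E}\left\{\begin{bmatrix}x_k\\ u_k\end{bmatrix}^TQ_j\begin{bmatrix}x_k\\ u_k\end{bmatrix}\right\},\qquad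 j=1,\dots,J,\ k=0,\dots,N-1,$$ is given by $$u_k=(R_k^\star)^T(X_k^\star)^{-1}x_k+v_k$$ with $$\mathbf{E}\{v_kv_k^T\}=\Pi_k^\star\qquad\text{and}\qquad \Pi_k^\star=U_k^\star-(R_k^\star)^T(X_k^\star)^{-1}R_k^\star.$$
   Context: Here $N$ is a positive integer, $x_k\in\mathbb{R}^n$, $u_k\in\mathbb{R}^m$, $v_k$ is a random vector in $\mathbb{R}^m$, and $A,A_1,\dots,A_M\in\mathbb{R}^{n\times n}$, $B\in\mathbb{R}^{n\times m}$, $C$, $D$ are given real matrices of compatible sizes with $\begin{bmatrix}C&D\end{bmatrix}^T\begin{bmatrix}C&D\end{bmatrix}\succ0$. The $Q_j$ are given real symmetric $(n+m)\times(n+m)$ matrices, with no other assumption (in particular they may be indefinite), and the $\gamma_j(k)$ are given real numbers. The sequences $\{w_k\}$ (with values in $\mathbb{R}^n$) and $\{\sigma_k(i)\}$ (real-valued, $i=1,\dots,M$) are independent zero-mean white noises with arbitrary probability distributions, satisfying $\mathbf{E}\{\sigma_k(i)w_\ell\}=0$ for all $i,k,\ell$, $\mathbf{E}\{w_kw_\ell^T\}=\delta(k-\ell)I$ and $\mathbf{E}\{\sigma_k(i)\sigma_\ell(i')\}=\delta(i-i')\delta(k-\ell)$, where $\delta(0)=1$ and $\delta(k)=0$ for $k\ne0$. The minimization in the control problem is over causal state-feedback controllers $\mu_k$, linear or nonlinear. $S\succeq0$ ($S\succ0$) means that $S$ is symmetric positive semidefinite (definite); $\mathbf{Tr}$ is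 the trace; $\mathbf{E}$ is expectation; $I$ and $I_n$ denote the $n\times n$ identity matrix.
   Formalization: The v_k are additionally taken to be independent of the noises as a sequence and uncorrelated over time (E{v_k v_l^T}=0 for k≠l), controllers may be randomized, and white noise means independent over time; for correlated v_k the claim fails. *)

theory Defs
  imports "HOL-Probability.Probability"
begin

section \<open>Block matrices and definiteness\<close>

text \<open>Matrices partitioned conformally with a state in \<open>real^'n\<close> and an input in \<open>real^'m\<close>
  are indexed by the sum type \<open>'n + 'm\<close>.\<close>

definition hcat :: "real^'n^'p \<Rightarrow> real^'m^'p \<Rightarrow> real^('n::finite + 'm::finite)^'p" where
  "hcat C D = (\<chi> i j. case j of Inl a \<Rightarrow> C $ i $ a | Inr b \<Rightarrow> D $ i $ b)"

definition vcat :: "real^'n \<Rightarrow> real^'m \<Rightarrow> real^('n::finite + 'm::finite)" where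
  "vcat x u = (\<chi> i. case i of Inl a \<Rightarrow> x $ a | Inr b \<Rightarrow> u $ b)"

definition block :: "real^'n^'n \<Rightarrow> real^'m^'n \<Rightarrow> real^'n^'m \<Rightarrow> real^'m^'m
    \<Rightarrow> real^('n::finite + 'm::finite)^('n + 'm)" where
  "block X R S U = (\<chi> i. case i of
     Inl a \<Rightarrow> vcat (X $ a) (R $ a)
   | Inr b \<Rightarrow> vcat (S $ b) (U $ b))"

definition F_mat :: "real^('n::finite + 'm::finite)^'n" where
  "F_mat = hcat (mat 1) 0"

definition pos_semidef :: "real^'n^'n \<Rightarrow> bool" where
  "pos_semidef S \<longleftrightarrow> transpose S = S \<and> (\<forall>x. 0 \<le> x \<bullet> (S *v x))"

definition pos_def :: "real^'n^'n \<Rightarrow> bool" where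
  "pos_def S \<longleftrightarrow> transpose S = S \<and> (\<forall>x. x \<noteq> 0 \<longrightarrow> 0 < x \<bullet> (S *v x))"

section \<open>The semidefinite program\<close>

definition sdp_feasible where
  "sdp_feasible (N::nat) (A :: real^'n^'n) (B :: real^'m^'n) (M::nat) (Am :: nat \<Rightarrow> real^'n^'n)
      (J::nat) (Q :: nat \<Rightarrow> real^('n::finite + 'm::finite)^('n + 'm)) (\<gamma> :: nat \<Rightarrow> nat \<Rightarrow> real)
      (V :: nat \<Rightarrow> real^('n::finite + 'm::finite)^('n + 'm)) \<longleftrightarrow>
     (\<forall>k<N. pos_semidef (V k)) \<and>
     F_mat ** V 0 ** transpose F_mat = (0 :: real^'n^'n) \<and>
     (\<forall>k. Suc k < N \<longrightarrow>
        F_mat ** V (Suc k) ** transpose F_mat =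
          hcat A B ** V k ** transpose (hcat A B)
          + (\<Sum>i\<in>{1..M}. Am i ** F_mat ** V k ** transpose F_mat ** transpose (Am i))
          + mat 1) \<and>
     (\<forall>j\<in>{1..J}. \<forall>k<N. \<gamma> j k \<ge> trace (Q j ** V k))"

definition sdp_objective where
  "sdp_objective (N::nat) (C :: real^'n^'p) (D :: real^'m^'p)
      (V :: nat \<Rightarrow> real^('n::finite + 'm::finite)^('n + 'm)) =
     1 / real N * (\<Sum>k<N. trace (hcat C D ** V k ** transpose (hcat C D)))"

definition sdp_solution where
  "sdp_solution N A B M Am C D J Q \<gamma> V \<longleftrightarrow>
     sdp_feasible N A B M Am J Q \<gamma> V \<and>
     (\<forall>V'. sdp_feasible N A B M Am J Q \<gamma> V' \<longrightarrow>
        sdp_objective N C D V \<le> sdp_objective N C D V')"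

section \<open>Noise\<close>

definition generated_events :: "'a measure \<Rightarrow> 'b measure \<Rightarrow> ('a \<Rightarrow> 'b) \<Rightarrow> 'a set set" where
  "generated_events P K X = {X -` E \<inter> space P | E. E \<in> sets K}"

definition mixed_moment :: "'a measure \<Rightarrow> ('a \<Rightarrow> real^'n) \<Rightarrow> ('a \<Rightarrow> real^'m) \<Rightarrow> real^'m^'n" where
  "mixed_moment P f g = (\<chi> i j. \<integral>\<omega>. f \<omega> $ i * g \<omega> $ j \<partial>P)"

text \<open>A Bochner integral is \<open>0\<close> when it does not exist, so moment conditions are only
  meaningful together with square integrability.\<close>

definition square_integrable :: "'a measure \<Rightarrow> ('a \<Rightarrow> 'b::real_normed_vector) \<Rightarrow> bool" where
  "square_integrable P f \<longleftrightarrow>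
     f \<in> borel_measurable P \<and> integrable P (\<lambda>\<omega>. (norm (f \<omega>))\<^sup>2)"

abbreviation noise_vec :: "nat \<Rightarrow> (nat \<Rightarrow> nat \<Rightarrow> 'a \<Rightarrow> real) \<Rightarrow> nat \<Rightarrow> 'a \<Rightarrow> nat \<Rightarrow> real" where
  "noise_vec M \<sigma> k \<omega> \<equiv> (\<lambda>i\<in>{1..M}. \<sigma> k i \<omega>)"

abbreviation noise_vec_space :: "nat \<Rightarrow> (nat \<Rightarrow> real) measure" where
  "noise_vec_space M \<equiv> Pi\<^sub>M {1..M} (\<lambda>_. borel)"

text \<open>White noise is independent (not just uncorrelated) over time: a nonlinear controller could
  otherwise predict the noise. Independence of \<open>\<sigma> k i\<close> for different \<open>i\<close> at the same
  time \<open>k\<close> is not required beyond the stated second moments.\<close>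

definition noise_model where
  "noise_model (P :: 'a measure) (w :: nat \<Rightarrow> 'a \<Rightarrow> real^'n) (M::nat)
      (\<sigma> :: nat \<Rightarrow> nat \<Rightarrow> 'a \<Rightarrow> real) \<longleftrightarrow>
     prob_space P \<and>
     (\<forall>k. square_integrable P (w k)) \<and>
     (\<forall>k. \<forall>i\<in>{1..M}. square_integrable P (\<sigma> k i)) \<and>
     prob_space.indep_vars P (\<lambda>_. borel) w UNIV \<and>
     prob_space.indep_vars P (\<lambda>_. noise_vec_space M) (noise_vec M \<sigma>) UNIV \<and>
     prob_space.indep_set P
       (generated_events P (Pi\<^sub>M UNIV (\<lambda>_. borel)) (\<lambda>\<omega> k. w k \<omega>))
       (generated_events P (Pi\<^sub>M UNIV (\<lambda>_. noise_vec_space M)) (\<lambda>\<omega> k. noise_vec M \<sigma> k \<omega>)) \<and>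
     (\<forall>k. (\<integral>\<omega>. w k \<omega> \<partial>P) = 0) \<and>
     (\<forall>k. \<forall>i\<in>{1..M}. (\<integral>\<omega>. \<sigma> k i \<omega> \<partial>P) = 0) \<and>
     (\<forall>k l. \<forall>i\<in>{1..M}. (\<integral>\<omega>. \<sigma> k i \<omega> *\<^sub>R w l \<omega> \<partial>P) = 0) \<and>
     (\<forall>k l. mixed_moment P (w k) (w l) = (if k = l then mat 1 else 0)) \<and>
     (\<forall>k l. \<forall>i\<in>{1..M}. \<forall>i'\<in>{1..M}.
        (\<integral>\<omega>. \<sigma> k i \<omega> * \<sigma> l i' \<omega> \<partial>P) = (if i = i' \<and> k = l then 1 else 0))"

text \<open>The sequence \<open>v\<close> consists of random vectors and, as a whole, is independent of the two
  noise sequences jointly.\<close>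

definition exogenous where
  "exogenous (P :: 'a measure) (w :: nat \<Rightarrow> 'a \<Rightarrow> real^'n) (M::nat)
      (\<sigma> :: nat \<Rightarrow> nat \<Rightarrow> 'a \<Rightarrow> real) (v :: nat \<Rightarrow> 'a \<Rightarrow> real^'m) \<longleftrightarrow>
     (\<forall>k. v k \<in> borel_measurable P) \<and>
     prob_space.indep_set P
       (generated_events P (Pi\<^sub>M UNIV (\<lambda>_. borel)) (\<lambda>\<omega> k. v k \<omega>))
       (generated_events P
         (Pi\<^sub>M UNIV (\<lambda>_. borel) \<Otimes>\<^sub>M Pi\<^sub>M UNIV (\<lambda>_. noise_vec_space M))
         (\<lambda>\<omega>. (\<lambda>k. w k \<omega>, \<lambda>k. noise_vec M \<sigma> k \<omega>)))"

section \<open>The constrained optimal control problem\<close>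

text \<open>A controller is a pair \<open>(\<mu>, v)\<close>, giving \<open>u\<^sub>k = \<mu> k (x\<^sub>0, \<dots>, x\<^sub>k) v\<^sub>k\<close>. The exogenous random
  vectors \<open>v\<close> make randomized controllers available; a deterministic controller
  is one that ignores its last argument. The history \<open>x\<^sub>0, \<dots>, x\<^sub>k\<close> is a function restricted
  to \<open>{..k}\<close>.\<close>

type_synonym ('n, 'm) policy = "nat \<Rightarrow> (nat \<Rightarrow> real^'n) \<Rightarrow> real^'m \<Rightarrow> real^'m"

context
  notes restrict_cong [unfolded simp_implies_def, fundef_cong]
begin

fun state :: "real^'n^'n \<Rightarrow> real^'m^'n \<Rightarrow> nat \<Rightarrow> (nat \<Rightarrow> real^'n^'n) \<Rightarrow>
    (nat \<Rightarrow> 'a \<Rightarrow> real^'n) \<Rightarrow> (nat \<Rightarrow> nat \<Rightarrow> 'a \<Rightarrow> real) \<Rightarrow>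
    ('n, 'm) policy \<Rightarrow> (nat \<Rightarrow> 'a \<Rightarrow> real^'m) \<Rightarrow> nat \<Rightarrow> 'a \<Rightarrow> real^'n" where
  "state A B M Am w \<sigma> \<mu> v 0 \<omega> = 0"
| "state A B M Am w \<sigma> \<mu> v (Suc k) \<omega> =
     (A + (\<Sum>i\<in>{1..M}. \<sigma> k i \<omega> *\<^sub>R Am i)) *v state A B M Am w \<sigma> \<mu> v k \<omega>
     + B *v \<mu> k (\<lambda>t\<in>{..k}. state A B M Am w \<sigma> \<mu> v t \<omega>) (v k \<omega>)
     + w k \<omega>"

end

definition input where
  "input A B M Am w \<sigma> \<mu> v k \<omega> =
     \<mu> k (\<lambda>t\<in>{..k}. state A B M Am w \<sigma> \<mu> v t \<omega>) (v k \<omega>)"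

definition admissible where
  "admissible (N::nat) P (w :: nat \<Rightarrow> 'a \<Rightarrow> real^'n) M \<sigma> (\<mu> :: ('n::finite, 'm::finite) policy)
      (v :: nat \<Rightarrow> 'a \<Rightarrow> real^'m) \<longleftrightarrow>
     (\<forall>k<N. (\<lambda>(h, r). \<mu> k h r) \<in> borel_measurable (Pi\<^sub>M {..k} (\<lambda>_. borel) \<Otimes>\<^sub>M borel)) \<and>
     exogenous P w M \<sigma> v"

definition control_feasible where
  "control_feasible N P A B M Am w \<sigma> (J::nat) Q \<gamma> \<mu> v \<longleftrightarrow>
     admissible N P w M \<sigma> \<mu> v \<and>
     (\<forall>j\<in>{1..J}. \<forall>k<N.
        let y = (\<lambda>\<omega>. vcat (state A B M Am w \<sigma> \<mu> v k \<omega>) (input A B M Am w \<sigma> \<mu> v k \<omega>)) in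
        integrable P (\<lambda>\<omega>. y \<omega> \<bullet> (Q j *v y \<omega>)) \<and>
        \<gamma> j k \<ge> (\<integral>\<omega>. y \<omega> \<bullet> (Q j *v y \<omega>) \<partial>P))"

text \<open>The cost is extended-real valued, so that controllers of infinite cost are
  not excluded from the comparison.\<close>

definition control_cost :: "nat \<Rightarrow> 'a measure \<Rightarrow> real^'n^'n \<Rightarrow> real^'m^'n \<Rightarrow> nat \<Rightarrow>
    (nat \<Rightarrow> real^'n^'n) \<Rightarrow> real^'n^'p \<Rightarrow> real^'m^'p \<Rightarrow> (nat \<Rightarrow> 'a \<Rightarrow> real^'n) \<Rightarrow>
    (nat \<Rightarrow> nat \<Rightarrow> 'a \<Rightarrow> real) \<Rightarrow> ('n, 'm) policy \<Rightarrow> (nat \<Rightarrow> 'a \<Rightarrow> real^'m) \<Rightarrow> ennreal" where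
  "control_cost N P A B M Am C D w \<sigma> \<mu> v =
     ennreal (1 / real N) * (\<Sum>k<N. \<integral>\<^sup>+\<omega>.
       (let z = C *v state A B M Am w \<sigma> \<mu> v k \<omega> + D *v input A B M Am w \<sigma> \<mu> v k \<omega>
        in ennreal (z \<bullet> z)) \<partial>P)"

definition optimal_controller where
  "optimal_controller N P A B M Am C D w \<sigma> J Q \<gamma> \<mu> v \<longleftrightarrow>
     control_feasible N P A B M Am w \<sigma> J Q \<gamma> \<mu> v \<and>
     (\<forall>\<mu>' v'. control_feasible N P A B M Am w \<sigma> J Q \<gamma> \<mu>' v' \<longrightarrow>
        control_cost N P A B M Am C D w \<sigma> \<mu> v \<le> control_cost N P A B M Am C D w \<sigma> \<mu>' v')"

end

theory Submission
  imports Defs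
begin

text \<open>Let \<open>V\<^sub>k\<close> be the second moment of \<open>(x\<^sub>k, u\<^sub>k)\<close>. Cost and constraints are linear in \<open>V\<^sub>k\<close>, and since
  the noises at time \<open>k\<close> are independent of the past, every controller of finite cost, linear or not,
  makes \<open>V\<^sub>k\<close> satisfy the recursion of the semidefinite program; hence the value of the program
  bounds every control cost from below. (Finite cost forces \<open>V\<^sub>k\<close> to exist because \<open>[C D]\<close> is
  injective.) The bound is attained: \<open>X\<^sub>0 = 0\<close> and \<open>X\<^sub>k\<close> dominates the identity for \<open>k > 0\<close>, so the gain
  \<open>K\<^sub>k = R\<^sub>k\<^sup>T X\<^sub>k\<^sup>-\<^sup>1\<close> satisfies \<open>K\<^sub>k X\<^sub>k = R\<^sub>k\<^sup>T\<close>, and adding \<open>v\<^sub>k\<close> with second moment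
  \<open>U\<^sub>k - K\<^sub>k R\<^sub>k\<close> reproduces the optimal \<open>V\<^sub>k\<close> by induction. The \<open>v\<^sub>k\<close> may have nonzero mean: the
  induction carries along \<open>E x\<^sub>k v\<^sub>l\<^sup>T = 0\<close> for \<open>l \<ge> k\<close>, which only needs \<open>E v\<^sub>k v\<^sub>l\<^sup>T = 0\<close> for \<open>k \<noteq> l\<close>.\<close>

section \<open>Block matrices and Schur complements\<close>

lemma sum_UNIV_Plus:
  fixes f :: "'a::finite + 'b::finite \<Rightarrow> 'c::comm_monoid_add"
  shows "(\<Sum>i\<in>UNIV. f i) = (\<Sum>a\<in>UNIV. f (Inl a)) + (\<Sum>b\<in>UNIV. f (Inr b))"
  by (subst UNIV_Plus_UNIV [symmetric], subst sum.Plus) auto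

lemma vcat_nth [simp]: "vcat x u $ Inl a = x $ a" "vcat x u $ Inr b = u $ b"
  by (simp_all add: vcat_def)

lemma hcat_nth [simp]: "hcat C D $ i $ Inl a = C $ i $ a" "hcat C D $ i $ Inr b = D $ i $ b"
  by (simp_all add: hcat_def)

lemma block_nth [simp]:
  "block X R S U $ Inl a = vcat (X $ a) (R $ a)"
  "block X R S U $ Inr b = vcat (S $ b) (U $ b)"
  by (simp_all add: block_def)

lemma vec_eq_sum_iff:
  fixes x y :: "'c^('a::finite + 'b::finite)"
  shows "x = y \<longleftrightarrow> (\<forall>a. x $ Inl a = y $ Inl a) \<and> (\<forall>b. x $ Inr b = y $ Inr b)"
  by (metis obj_sumE vec_eq_iff)

lemma hcat_mult_vcat: "hcat A B *v vcat x u = A *v x + B *v (u :: real^'m)"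
  by (simp add: vec_eq_iff matrix_vector_mult_def sum_UNIV_Plus)

lemma F_mat_mult_vcat: "F_mat *v vcat x u = (x :: real^'n)"
  by (simp add: F_mat_def hcat_mult_vcat)

lemma block_mult_vcat: "block X R S U *v vcat a b = vcat (X *v a + R *v b) (S *v a + U *v b)"
  by (simp add: vec_eq_sum_iff matrix_vector_mult_def sum_UNIV_Plus)

lemma inner_vcat: "vcat a b \<bullet> vcat c d = a \<bullet> c + b \<bullet> d"
  by (simp add: inner_vec_def sum_UNIV_Plus)

lemma transpose_block:
  "transpose (block X R S U) = block (transpose X) (transpose S) (transpose R) (transpose U)"
  by (simp add: vec_eq_sum_iff transpose_def)

lemma block_eq_iff:
  "block X R S U = block X' R' S' U' \<longleftrightarrow> X = X' \<and> R = R' \<and> S = S' \<and> U = U'"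
proof
  assume eq: "block X R S U = block X' R' S' U'"
  have "X = X'" "R = R'" "S = S'" "U = U'"
    using arg_cong [OF eq, of "\<lambda>V. V $ Inl a $ Inl b" for a b]
      arg_cong [OF eq, of "\<lambda>V. V $ Inl a $ Inr b" for a b]
      arg_cong [OF eq, of "\<lambda>V. V $ Inr a $ Inl b" for a b]
      arg_cong [OF eq, of "\<lambda>V. V $ Inr a $ Inr b" for a b]
    by (simp_all add: vec_eq_iff)
  then show "X = X' \<and> R = R' \<and> S = S' \<and> U = U'" by simp
qed simp

lemma F_mat_block: "F_mat ** block X R S U ** transpose F_mat = X"
proof -
  have [simp]: "F_mat $ i $ Inl a = (if i = a then 1 else 0)" "F_mat $ i $ Inr b = 0"
    for i a :: 'a and b :: 'b
    by (simp_all add: F_mat_def mat_def)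
  show ?thesis
    by (simp add: vec_eq_iff matrix_matrix_mult_def transpose_def sum_UNIV_Plus if_distrib
        if_distribR sum.delta cong: if_cong)
qed

lemma matrix_vector_mult_sum_rdistrib:
  fixes S :: "'i \<Rightarrow> real^'n^'m"
  shows "(\<Sum>i\<in>I. S i) *v x = (\<Sum>i\<in>I. S i *v x)"
  by (induction I rule: infinite_finite_induct) (simp_all add: matrix_vector_mult_add_rdistrib)

text \<open>Concatenation becomes a sum of two matrix actions, so its measurability and square
  integrability reduce to those of sums and linear images.\<close>

lemma vcat_eq: "vcat x u = (\<chi> i j. if i = Inl j then 1 else 0) *v x + (\<chi> i j. if i = Inr j then 1 else 0) *v u"
  by (simp add: vec_eq_sum_iff matrix_vector_mult_def if_distrib if_distribR cong: if_cong)

lemma inner_matrix_mult_transpose: "x \<bullet> (S *v (y :: real^'m)) = (transpose S *v x) \<bullet> y"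
  by (simp add: dot_lmul_matrix)

lemma transpose_add: "transpose (S + T) = transpose S + transpose (T :: real^'n^'m)"
  by (simp add: vec_eq_iff transpose_def)

lemma transpose_diff: "transpose (S - T) = transpose S - transpose (T :: real^'n^'m)"
  by (simp add: vec_eq_iff transpose_def)

lemma transpose_0: "transpose 0 = (0 :: real^'n^'m)"
  by (simp add: vec_eq_iff transpose_def)

section \<open>Closure properties of positive semidefinite matrices\<close>

lemma pos_semidef_congruence:
  assumes "pos_semidef V"
  shows "pos_semidef (K ** V ** transpose K)"
  unfolding pos_semidef_def
proof (intro conjI allI)
  show "transpose (K ** V ** transpose K) = K ** V ** transpose K"
    using assms by (simp add: pos_semidef_def matrix_transpose_mul matrix_mul_assoc)
  show "0 \<le> x \<bullet> (K ** V ** transpose K *v x)" for x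
  proof -
    have "x \<bullet> (K ** V ** transpose K *v x) = (transpose K *v x) \<bullet> (V *v (transpose K *v x))"
      by (simp only: inner_matrix_mult_transpose [of x K] flip: matrix_vector_mul_assoc)
    then show ?thesis
      using assms by (simp only: pos_semidef_def)
  qed
qed

lemma pos_semidef_0: "pos_semidef 0"
  by (simp add: pos_semidef_def transpose_0)

lemma pos_semidef_add:
  assumes "pos_semidef S" "pos_semidef T"
  shows "pos_semidef (S + T)"
  using assms by (simp add: pos_semidef_def transpose_add matrix_vector_mult_add_rdistrib inner_add_right)

lemma pos_semidef_sum:
  assumes "\<And>i. i \<in> I \<Longrightarrow> pos_semidef (S i)"
  shows "pos_semidef (\<Sum>i\<in>I. S i)"
  using assms by (induction I rule: infinite_finite_induct) (auto intro: pos_semidef_0 pos_semidef_add)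

text \<open>If \<open>S + mat 1\<close> identifies \<open>x\<close> and \<open>y\<close>, then
  \<open>d = x - y\<close> satisfies \<open>d \<bullet> (S *v d) + d \<bullet> d = 0\<close>. Both
  terms are nonnegative, so \<open>d = 0\<close>, and an injective square matrix is invertible. This
  applies to every \<open>X k\<close> with \<open>k > 0\<close>.\<close>

lemma invertible_pos_semidef_add_mat_1:
  assumes "pos_semidef S"
  shows "invertible (S + mat 1)"
proof -
  have "inj ((*v) (S + mat 1))"
  proof (rule injI)
    fix x y assume "(S + mat 1) *v x = (S + mat 1) *v y"
    then have "S *v (x - y) + (x - y) = 0"
      by (simp add: matrix_vector_mult_add_rdistrib matrix_vector_mult_diff_distrib algebra_simps)
    then have "(x - y) \<bullet> (S *v (x - y)) + (x - y) \<bullet> (x - y) = 0"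
      by (metis inner_add_right inner_zero_right)
    moreover have "0 \<le> (x - y) \<bullet> (S *v (x - y))"
      using assms by (simp add: pos_semidef_def)
    ultimately have "(x - y) \<bullet> (x - y) = 0"
      by (smt (verit) inner_ge_zero)
    then show "x = y" by simp
  qed
  then show ?thesis
    by (simp add: invertible_left_inverse matrix_left_invertible_injective)
qed

section \<open>Semidefinite block matrices, gains and Schur complements\<close>

lemma inner_block_vcat:
  fixes R :: "real^'m^'n"
  shows "vcat a b \<bullet> (block X R (transpose R) U *v vcat a b) =
    a \<bullet> (X *v a) + 2 * (a \<bullet> (R *v b)) + b \<bullet> (U *v b)"
proof -
  have "b \<bullet> (transpose R *v a) = a \<bullet> (R *v b)"
    by (metis inner_commute inner_matrix_mult_transpose transpose_transpose)
  then show ?thesis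
    by (simp only: block_mult_vcat inner_vcat inner_add_right)
qed

lemma pos_semidef_blockD:
  assumes "pos_semidef (block X R (transpose R) U)"
  shows "transpose X = X" "transpose U = U"
    "0 \<le> a \<bullet> (X *v a) + 2 * (a \<bullet> (R *v b)) + b \<bullet> (U *v b)"
proof -
  have "transpose (block X R (transpose R) U) = block X R (transpose R) U"
    using assms by (simp only: pos_semidef_def)
  then show "transpose X = X" "transpose U = U"
    unfolding transpose_block block_eq_iff by blast+
  show "0 \<le> a \<bullet> (X *v a) + 2 * (a \<bullet> (R *v b)) + b \<bullet> (U *v b)"
    using assms unfolding pos_semidef_def inner_block_vcat [symmetric] by blast
qed

text \<open>The convention for the inverse of \<open>X = 0\<close> (the initial state) is immaterial, since
  positive semidefiniteness then forces \<open>R = 0\<close>.\<close>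

lemma pos_semidef_block_gain:
  assumes V: "pos_semidef (block X R (transpose R) U)" and "X = 0 \<or> invertible X"
  shows "transpose R ** matrix_inv X ** X = transpose R"
  using assms(2)
proof
  assume "invertible X"
  then have "matrix_inv X ** X = mat 1"
    unfolding matrix_inv_def invertible_def by (rule someI2_ex) blast
  then show ?thesis
    by (simp flip: matrix_mul_assoc)
next
  assume X: "X = 0"
  have "R *v b = 0" for b
  proof (rule ccontr)
    assume "R *v b \<noteq> 0"
    then have pos: "(R *v b) \<bullet> (R *v b) > 0" by simp
    \<comment> \<open>With \<open>X = 0\<close> the block form has no quadratic term in its first
      argument. Moving that argument along \<open>- R *v b\<close> by this \<open>t\<close> makes
      the cross term \<open>- 2 * (\<bar>b \<bullet> (U *v b)\<bar> + 1)\<close>, which outweighs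
      the remaining \<open>b \<bullet> (U *v b)\<close>.\<close>
    define t where "t = (\<bar>b \<bullet> (U *v b)\<bar> + 1) / ((R *v b) \<bullet> (R *v b))"
    have "0 \<le> 2 * (((- t) *\<^sub>R (R *v b)) \<bullet> (R *v b)) + b \<bullet> (U *v b)"
      using pos_semidef_blockD(3) [OF V, of "(- t) *\<^sub>R (R *v b)" b] X by simp
    also have "\<dots> = - 2 * (\<bar>b \<bullet> (U *v b)\<bar> + 1) + b \<bullet> (U *v b)"
      using pos by (simp add: t_def)
    finally show False
      using abs_ge_self [of "b \<bullet> (U *v b)"] abs_ge_zero [of "b \<bullet> (U *v b)"] by simp
  qed
  then have "R = 0"
    by (simp add: matrix_eq)
  then show ?thesis
    by (simp add: X transpose_0)
qed

text \<open>The gain enters through \<open>K ** X = transpose R\<close> instead of an inverse of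
  \<open>X\<close>, so that the singular case \<open>X = 0\<close> is included. Minimising the block
  form over its first argument leaves exactly the form of \<open>U - K ** R\<close>.\<close>

lemma pos_semidef_Schur_complement:
  assumes V: "pos_semidef (block X R (transpose R) U)" and KX: "K ** X = transpose R"
  shows "R = X ** transpose K" "pos_semidef (U - K ** R)"
proof -
  note sym = pos_semidef_blockD(1,2) [OF V]
  show R: "R = X ** transpose K"
    by (metis KX matrix_transpose_mul sym(1) transpose_transpose)
  show "pos_semidef (U - K ** R)"
    unfolding pos_semidef_def
  proof (intro conjI allI)
    show "transpose (U - K ** R) = U - K ** R"
      by (simp add: R transpose_diff matrix_transpose_mul sym matrix_mul_assoc)
    fix b
    \<comment> \<open>This is the minimiser of the block form for fixed \<open>b\<close>: since
      \<open>R = X ** transpose K\<close>, the gradient is proportional to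
      \<open>X *v (a + transpose K *v b)\<close> and vanishes here.\<close>
    let ?a = "- (transpose K *v b)"
    have "?a \<bullet> (X *v ?a) = b \<bullet> (K ** R *v b)"
      by (simp add: R inner_matrix_mult_transpose [of b K] linear_neg [OF matrix_vector_mul_linear] flip: matrix_vector_mul_assoc
          del: transpose_matrix_vector)
    moreover have "?a \<bullet> (R *v b) = - (b \<bullet> (K ** R *v b))"
      by (simp add: inner_matrix_mult_transpose [of b K] flip: matrix_vector_mul_assoc
          del: transpose_matrix_vector)
    ultimately show "0 \<le> b \<bullet> ((U - K ** R) *v b)"
      using pos_semidef_blockD(3) [OF V, of ?a b]
      by (simp add: matrix_vector_mult_diff_rdistrib inner_diff_right del: transpose_matrix_vector)
  qed
qed

text \<open>A positive definite Gram matrix forces injectivity, and an injective linear map in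
  finite dimension is bounded below. Applied to \<open>hcat C D\<close>, this bounds state and input
  by the output.\<close>

lemma pos_def_gram_bounded_below:
  fixes K :: "real^'n^'m"
  assumes "pos_def (transpose K ** K)"
  obtains c where "c > 0" "\<And>y. c * norm y \<le> norm (K *v y)"
proof -
  have "inj ((*v) K)"
  proof (rule injI)
    fix x y assume "K *v x = K *v y"
    then have "(transpose K ** K) *v (x - y) = 0"
      by (simp add: matrix_vector_mult_diff_distrib del: transpose_matrix_vector
          flip: matrix_vector_mul_assoc)
    then show "x = y"
      using assms unfolding pos_def_def by (metis inner_zero_right less_irrefl right_minus_eq)
  qed
  from linear_inj_bounded_below_pos [OF matrix_vector_mul_linear this] that show ?thesis
    by blast
qed

section \<open>Square integrability and second moments\<close>

lemma square_integrableD: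
  assumes "square_integrable P f"
  shows "f \<in> borel_measurable P" "integrable P (\<lambda>\<omega>. (norm (f \<omega>))\<^sup>2)"
  using assms by (simp_all add: square_integrable_def)

lemma square_integrable_bound:
  assumes "square_integrable P g" and [measurable]: "f \<in> borel_measurable P"
    and "\<And>\<omega>. norm (f \<omega>) \<le> c * norm (g \<omega>)"
  shows "square_integrable P f"
  unfolding square_integrable_def
proof
  show "integrable P (\<lambda>\<omega>. (norm (f \<omega>))\<^sup>2)"
  proof (rule Bochner_Integration.integrable_bound)
    show "integrable P (\<lambda>\<omega>. c\<^sup>2 * (norm (g \<omega>))\<^sup>2)"
      using square_integrableD(2) [OF assms(1)] by simp
    show "AE \<omega> in P. norm ((norm (f \<omega>))\<^sup>2) \<le> norm (c\<^sup>2 * (norm (g \<omega>))\<^sup>2)"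
      using power_mono [OF assms(3) norm_ge_zero, where n = 2] by (simp add: power_mult_distrib)
  qed measurable
qed fact

lemma square_integrable_bounded_linear:
  assumes "bounded_linear h" and f: "square_integrable P f"
  shows "square_integrable P (\<lambda>\<omega>. h (f \<omega>))"
proof -
  interpret h: bounded_linear h by fact
  obtain c where c: "\<And>x. norm (h x) \<le> norm x * c" using h.bounded by blast
  show ?thesis
  proof (rule square_integrable_bound [OF f, where c = c])
    show "(\<lambda>\<omega>. h (f \<omega>)) \<in> borel_measurable P"
      using square_integrableD(1) [OF f]
        borel_measurable_continuous_onI [OF h.continuous_on [OF continuous_on_id]]
      by (rule measurable_compose)
  qed (use c in \<open>simp add: mult.commute\<close>)
qed

lemma square_integrable_0: "square_integrable P (\<lambda>_. 0)"
  by (simp add: square_integrable_def)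

lemma square_integrable_add:
  fixes f g :: "'a \<Rightarrow> 'b::{real_normed_vector, second_countable_topology}"
  assumes "square_integrable P f" "square_integrable P g"
  shows "square_integrable P (\<lambda>\<omega>. f \<omega> + g \<omega>)"
proof -
  note [measurable] = assms [THEN square_integrableD(1)]
  have "integrable P (\<lambda>\<omega>. (norm (f \<omega> + g \<omega>))\<^sup>2)"
  proof (rule Bochner_Integration.integrable_bound)
    show "integrable P (\<lambda>\<omega>. 2 * (norm (f \<omega>))\<^sup>2 + 2 * (norm (g \<omega>))\<^sup>2)"
      using assms [THEN square_integrableD(2)] by simp
    have "(norm (f \<omega> + g \<omega>))\<^sup>2 \<le> 2 * (norm (f \<omega>))\<^sup>2 + 2 * (norm (g \<omega>))\<^sup>2" for \<omega>
      using power_mono [OF norm_triangle_ineq norm_ge_zero, of "f \<omega>" "g \<omega>" 2]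
        zero_le_power2 [of "norm (f \<omega>) - norm (g \<omega>)"]
      by (simp add: power2_sum power2_diff)
    then show "AE \<omega> in P. norm ((norm (f \<omega> + g \<omega>))\<^sup>2) \<le>
        norm (2 * (norm (f \<omega>))\<^sup>2 + 2 * (norm (g \<omega>))\<^sup>2)"
      by simp
  qed measurable
  then show ?thesis by (simp add: square_integrable_def)
qed

lemma square_integrable_sum:
  fixes f :: "'i \<Rightarrow> 'a \<Rightarrow> 'b::{real_normed_vector, second_countable_topology}"
  assumes "\<And>i. i \<in> I \<Longrightarrow> square_integrable P (f i)"
  shows "square_integrable P (\<lambda>\<omega>. \<Sum>i\<in>I. f i \<omega>)"
  using assms
  by (induction I rule: infinite_finite_induct)
    (auto intro: square_integrable_0 square_integrable_add)

lemma square_integrable_nth: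
  fixes f :: "'a \<Rightarrow> real^'n"
  shows "square_integrable P f \<Longrightarrow> square_integrable P (\<lambda>\<omega>. f \<omega> $ i)"
  by (rule square_integrable_bounded_linear [OF bounded_linear_vec_nth])

lemma borel_measurable_nth:
  fixes f :: "'a \<Rightarrow> real^'n"
  shows "f \<in> borel_measurable P \<Longrightarrow> (\<lambda>\<omega>. f \<omega> $ i) \<in> borel_measurable P"
  by (erule measurable_compose)
    (rule borel_measurable_continuous_onI [OF bounded_linear.continuous_on
        [OF bounded_linear_vec_nth continuous_on_id]])

lemma measurable_mult_vec:
  fixes S :: "real^'i^'j"
  assumes "f \<in> borel_measurable K"
  shows "(\<lambda>\<omega>. S *v f \<omega>) \<in> borel_measurable K"
  using assms by (rule measurable_compose)
    (rule borel_measurable_continuous_onI [OF bounded_linear.continuous_on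
        [OF matrix_vector_mul_bounded_linear continuous_on_id]])

lemma measurable_vcat:
  assumes "f \<in> borel_measurable K" "g \<in> borel_measurable K"
  shows "(\<lambda>\<omega>. vcat (f \<omega>) (g \<omega>)) \<in> borel_measurable K"
  unfolding vcat_eq using assms by (intro borel_measurable_add measurable_mult_vec)

lemma square_integrable_mult_vec:
  fixes f :: "'a \<Rightarrow> real^'n"
  shows "square_integrable P f \<Longrightarrow> square_integrable P (\<lambda>\<omega>. S *v f \<omega>)"
  by (rule square_integrable_bounded_linear [OF matrix_vector_mul_bounded_linear])

lemma square_integrable_vcat:
  "square_integrable P f \<Longrightarrow> square_integrable P g \<Longrightarrow> square_integrable P (\<lambda>\<omega>. vcat (f \<omega>) (g \<omega>))"
  unfolding vcat_eq by (intro square_integrable_add square_integrable_mult_vec)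

lemma integrable_inner_square_integrable:
  fixes f g :: "'a \<Rightarrow> 'b::euclidean_space"
  assumes "square_integrable P f" "square_integrable P g"
  shows "integrable P (\<lambda>\<omega>. f \<omega> \<bullet> g \<omega>)"
proof (rule Bochner_Integration.integrable_bound)
  note [measurable] = assms [THEN square_integrableD(1)]
  show "integrable P (\<lambda>\<omega>. (norm (f \<omega>))\<^sup>2 + (norm (g \<omega>))\<^sup>2)"
    using assms [THEN square_integrableD(2)] by simp
  show "(\<lambda>\<omega>. f \<omega> \<bullet> g \<omega>) \<in> borel_measurable P" by measurable
  have "\<bar>f \<omega> \<bullet> g \<omega>\<bar> \<le> (norm (f \<omega>))\<^sup>2 + (norm (g \<omega>))\<^sup>2" for \<omega>
    using Cauchy_Schwarz_ineq2 [of "f \<omega>" "g \<omega>"]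
      zero_le_power2 [of "norm (f \<omega>) - norm (g \<omega>)"] zero_le_power2 [of "norm (f \<omega>)"]
      zero_le_power2 [of "norm (g \<omega>)"] mult_nonneg_nonneg [of "norm (f \<omega>)" "norm (g \<omega>)"]
    by (simp add: power2_diff)
  then show "AE \<omega> in P. norm (f \<omega> \<bullet> g \<omega>) \<le> norm ((norm (f \<omega>))\<^sup>2 + (norm (g \<omega>))\<^sup>2)"
    by simp
qed

lemma integrable_mult_square_integrable:
  fixes f g :: "'a \<Rightarrow> real"
  shows "square_integrable P f \<Longrightarrow> square_integrable P g \<Longrightarrow> integrable P (\<lambda>\<omega>. f \<omega> * g \<omega>)"
  using integrable_inner_square_integrable [of P f g] by simp

lemma integrable_mult_nth:
  fixes f :: "'a \<Rightarrow> real^'n" and g :: "'a \<Rightarrow> real^'m"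
  shows "square_integrable P f \<Longrightarrow> square_integrable P g \<Longrightarrow> integrable P (\<lambda>\<omega>. f \<omega> $ i * g \<omega> $ j)"
  by (intro integrable_mult_square_integrable square_integrable_nth)

section \<open>Calculus of matrix-valued second moments\<close>

lemma mixed_moment_nth: "mixed_moment P f g $ i $ j = (\<integral>\<omega>. f \<omega> $ i * g \<omega> $ j \<partial>P)"
  by (simp add: mixed_moment_def)

lemma transpose_mixed_moment: "transpose (mixed_moment P f g) = mixed_moment P g f"
  by (simp add: vec_eq_iff transpose_def mixed_moment_nth mult.commute)

lemma mixed_moment_add_left:
  assumes "square_integrable P f" "square_integrable P f'" "square_integrable P g"
  shows "mixed_moment P (\<lambda>\<omega>. f \<omega> + f' \<omega>) g = mixed_moment P f g + mixed_moment P f' g"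
  using assms by (simp add: vec_eq_iff mixed_moment_nth distrib_right integrable_mult_nth)

lemma mixed_moment_add_right:
  assumes "square_integrable P f" "square_integrable P g" "square_integrable P g'"
  shows "mixed_moment P f (\<lambda>\<omega>. g \<omega> + g' \<omega>) = mixed_moment P f g + mixed_moment P f g'"
  using assms by (simp add: vec_eq_iff mixed_moment_nth distrib_left integrable_mult_nth)

lemma mixed_moment_sum_left:
  assumes "\<And>i. i \<in> I \<Longrightarrow> square_integrable P (f i)" "square_integrable P g"
  shows "mixed_moment P (\<lambda>\<omega>. \<Sum>i\<in>I. f i \<omega>) g = (\<Sum>i\<in>I. mixed_moment P (f i) g)"
  using assms by (simp add: vec_eq_iff mixed_moment_nth sum_distrib_right integrable_mult_nth)

lemma mixed_moment_sum_right:
  assumes "\<And>i. i \<in> I \<Longrightarrow> square_integrable P (g i)" "square_integrable P f"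
  shows "mixed_moment P f (\<lambda>\<omega>. \<Sum>i\<in>I. g i \<omega>) = (\<Sum>i\<in>I. mixed_moment P f (g i))"
  using assms by (simp add: vec_eq_iff mixed_moment_nth sum_distrib_left integrable_mult_nth)

lemma mixed_moment_mult_left:
  assumes "square_integrable P f" "square_integrable P g"
  shows "mixed_moment P (\<lambda>\<omega>. S *v f \<omega>) g = S ** mixed_moment P f g"
  using assms
  by (simp add: vec_eq_iff mixed_moment_nth matrix_vector_mult_def matrix_matrix_mult_def
      sum_distrib_right integrable_mult_nth mult.assoc)

lemma mixed_moment_mult_right:
  assumes "square_integrable P f" "square_integrable P g"
  shows "mixed_moment P f (\<lambda>\<omega>. S *v g \<omega>) = mixed_moment P f g ** transpose S"
  by (metis assms mixed_moment_mult_left matrix_transpose_mul transpose_mixed_moment transpose_transpose)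

lemma mixed_moment_vcat:
  "mixed_moment P (\<lambda>\<omega>. vcat (f \<omega>) (g \<omega>)) (\<lambda>\<omega>. vcat (f \<omega>) (g \<omega>)) =
    block (mixed_moment P f f) (mixed_moment P f g) (mixed_moment P g f) (mixed_moment P g g)"
  by (simp add: vec_eq_sum_iff mixed_moment_nth)

lemma trace_mixed_moment:
  assumes "square_integrable P f" "square_integrable P g"
  shows "trace (mixed_moment P f g) = (\<integral>\<omega>. f \<omega> \<bullet> g \<omega> \<partial>P)"
  using assms by (simp add: trace_def mixed_moment_nth inner_vec_def integrable_mult_nth)

text \<open>The quadratic form of the moment matrix at \<open>x\<close> is the expectation of the
  square of \<open>x \<bullet> f \<omega>\<close>.\<close>

lemma pos_semidef_mixed_moment:
  assumes f: "square_integrable P f"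
  shows "pos_semidef (mixed_moment P f f)"
  unfolding pos_semidef_def
proof (intro conjI allI)
  fix x
  have "x \<bullet> (mixed_moment P f f *v x) = (\<Sum>i\<in>UNIV. \<Sum>j\<in>UNIV. \<integral>\<omega>. x $ i * (f \<omega> $ i * f \<omega> $ j * x $ j) \<partial>P)"
    using f by (simp add: inner_vec_def matrix_vector_mult_def mixed_moment_nth sum_distrib_left
        integrable_mult_nth)
  also have "\<dots> = (\<integral>\<omega>. (\<Sum>i\<in>UNIV. \<Sum>j\<in>UNIV. x $ i * (f \<omega> $ i * f \<omega> $ j * x $ j)) \<partial>P)"
    using f by (simp add: integrable_mult_nth)
  also have "\<dots> = (\<integral>\<omega>. (x \<bullet> f \<omega>) * (x \<bullet> f \<omega>) \<partial>P)"
    by (simp add: inner_vec_def sum_product mult_ac)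
  finally show "0 \<le> x \<bullet> (mixed_moment P f f *v x)"
    by simp
qed (rule transpose_mixed_moment)

lemma mixed_moment_congruence:
  assumes "square_integrable P f"
  shows "mixed_moment P (\<lambda>\<omega>. S *v f \<omega>) (\<lambda>\<omega>. S *v f \<omega>) = S ** mixed_moment P f f ** transpose S"
  using assms
  by (simp add: mixed_moment_mult_left mixed_moment_mult_right square_integrable_mult_vec matrix_mul_assoc)

text \<open>An expected quadratic form depends on \<open>f\<close> only through its second moment,
  and linearly. This is the bridge between the control constraints and the trace constraints, for
  indefinite \<open>S\<close> as well.\<close>

lemma integral_quadratic_form:
  assumes "square_integrable P f"
  shows "integrable P (\<lambda>\<omega>. f \<omega> \<bullet> (S *v f \<omega>))"
    and "(\<integral>\<omega>. f \<omega> \<bullet> (S *v f \<omega>) \<partial>P) = trace (S ** mixed_moment P f f)"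
proof -
  note Sf = square_integrable_mult_vec [OF assms, of S]
  show "integrable P (\<lambda>\<omega>. f \<omega> \<bullet> (S *v f \<omega>))"
    by (rule integrable_inner_square_integrable [OF assms Sf])
  show "(\<integral>\<omega>. f \<omega> \<bullet> (S *v f \<omega>) \<partial>P) = trace (S ** mixed_moment P f f)"
    unfolding mixed_moment_mult_left [OF assms assms, symmetric] trace_mixed_moment [OF Sf assms]
    by (simp add: inner_commute)
qed

section \<open>Product rules for moments under independence\<close>

lemma subalgebra_space: "subalgebra N F \<Longrightarrow> space F = space N"
  by (simp add: subalgebra_def)

context prob_space
begin

text \<open>The events generated by \<open>f\<close> lie in \<open>sets G\<close> and those
  generated by \<open>g\<close> in \<open>sets H\<close>, so independence is inherited from the
  larger families.\<close>

lemma indep_var_subalgebra: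
  assumes G: "subalgebra M G" and H: "subalgebra M H" and GH: "indep_set (sets G) (sets H)"
    and f: "f \<in> measurable G S" and g: "g \<in> measurable H T"
  shows "indep_var S f T g"
  unfolding indep_var_eq
proof (intro conjI)
  show "random_variable S f" "random_variable T g"
    using measurable_from_subalg G H f g by blast+
  have "sigma_sets (space M) {f -` A \<inter> space M |A. A \<in> sets S} \<subseteq> sets G"
    unfolding subalgebra_space [OF G, symmetric]
    by (intro sets.sigma_sets_subset) (use f in \<open>auto simp: measurable_sets\<close>)
  moreover have "sigma_sets (space M) {g -` A \<inter> space M |A. A \<in> sets T} \<subseteq> sets H"
    unfolding subalgebra_space [OF H, symmetric]
    by (intro sets.sigma_sets_subset) (use g in \<open>auto simp: measurable_sets\<close>)
  ultimately show "indep_set (sigma_sets (space M) {f -` A \<inter> space M |A. A \<in> sets S})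
      (sigma_sets (space M) {g -` A \<inter> space M |A. A \<in> sets T})"
    using GH unfolding indep_sets2_eq by (meson order_trans subsetD)
qed

text \<open>Constants are integrable on a probability space, and
  \<open>(norm (f \<omega>) - 1)^2 \<ge> 0\<close> yields the dominating function
  \<open>1 + norm^2\<close>.\<close>

lemma square_integrable_imp_integrable:
  fixes f :: "'a \<Rightarrow> 'b::euclidean_space"
  assumes "square_integrable M f"
  shows "integrable M f"
proof (rule Bochner_Integration.integrable_bound)
  show "integrable M (\<lambda>\<omega>. 1 + (norm (f \<omega>))\<^sup>2)"
    using assms by (simp add: square_integrable_def)
  have "norm (f \<omega>) \<le> 1 + (norm (f \<omega>))\<^sup>2" for \<omega>
    using zero_le_power2 [of "norm (f \<omega>) - 1"] norm_ge_zero [of "f \<omega>"]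
    by (simp add: power2_diff del: norm_ge_zero)
  then show "AE \<omega> in M. norm (f \<omega>) \<le> norm (1 + (norm (f \<omega>))\<^sup>2)" by simp
qed (use assms in \<open>simp add: square_integrable_def\<close>)

end

text \<open>Interpreted below with \<open>G\<close> generated by the fresh gain noise or the fresh
  state noise at one time, and \<open>H\<close> by what precedes that noise.\<close>

locale indep_subalgebras = prob_space +
  fixes G H
  assumes subalgebra_G: "subalgebra M G" and subalgebra_H: "subalgebra M H"
    and indep_set: "indep_set (sets G) (sets H)"
begin

lemma
  fixes f g :: "'a \<Rightarrow> real"
  assumes "f \<in> borel_measurable G" "g \<in> borel_measurable H" "integrable M f" "integrable M g"
  shows integrable_mult_indep: "integrable M (\<lambda>\<omega>. f \<omega> * g \<omega>)"
    and integral_mult_indep: "(\<integral>\<omega>. f \<omega> * g \<omega> \<partial>M) = (\<integral>\<omega>. f \<omega> \<partial>M) * (\<integral>\<omega>. g \<omega> \<partial>M)"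
proof -
  have "indep_var borel f borel g"
    by (rule indep_var_subalgebra) (use assms subalgebra_G subalgebra_H indep_set in auto)
  then show "integrable M (\<lambda>\<omega>. f \<omega> * g \<omega>)" "(\<integral>\<omega>. f \<omega> * g \<omega> \<partial>M) = (\<integral>\<omega>. f \<omega> \<partial>M) * (\<integral>\<omega>. g \<omega> \<partial>M)"
    using assms by (auto intro: indep_var_integrable indep_var_lebesgue_integral)
qed

text \<open>In general a product of square integrable functions is merely integrable. Here the
  squared norm is a product of independent integrable functions, so the product stays square
  integrable and the closed loop keeps finite second moments.\<close>

lemma square_integrable_scaleR_indep:
  fixes f :: "'a \<Rightarrow> 'b::euclidean_space"
  assumes [measurable]: "h \<in> borel_measurable G" "f \<in> borel_measurable H"
    and L2: "square_integrable M h" "square_integrable M f"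
  shows "square_integrable M (\<lambda>\<omega>. h \<omega> *\<^sub>R f \<omega>)"
  unfolding square_integrable_def
proof
  note [measurable] = L2 [THEN square_integrableD(1)]
  show "(\<lambda>\<omega>. h \<omega> *\<^sub>R f \<omega>) \<in> borel_measurable M" by measurable
  have "integrable M (\<lambda>\<omega>. (norm (h \<omega>))\<^sup>2 * (norm (f \<omega>))\<^sup>2)"
    by (intro integrable_mult_indep square_integrableD(2) [OF L2(1)] square_integrableD(2) [OF L2(2)])
       measurable
  then show "integrable M (\<lambda>\<omega>. (norm (h \<omega> *\<^sub>R f \<omega>))\<^sup>2)"
    by (simp add: power_mult_distrib)
qed

text \<open>Each entry factors into two expectations, of which the one of \<open>f\<close> is zero.
  The mean of \<open>g\<close> is arbitrary, as suits nonlinear functions of the past.\<close>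

lemma mixed_moment_indep_eq_0:
  assumes [measurable]: "f \<in> borel_measurable G" "g \<in> borel_measurable H"
    and L2: "square_integrable M f" "square_integrable M g" and "(\<integral>\<omega>. f \<omega> \<partial>M) = 0"
  shows "mixed_moment M f g = 0" "mixed_moment M g f = 0"
proof -
  have "(\<integral>\<omega>. f \<omega> $ i \<partial>M) = (\<integral>\<omega>. f \<omega> \<partial>M) $ i" for i
    by (rule integral_bounded_linear [OF bounded_linear_vec_nth])
      (rule square_integrable_imp_integrable [OF L2(1)])
  then have "(\<integral>\<omega>. f \<omega> $ i * g \<omega> $ j \<partial>M) = 0" for i j
    using integral_mult_indep [of "\<lambda>\<omega>. f \<omega> $ i" "\<lambda>\<omega>. g \<omega> $ j"] assms
    by (simp add: square_integrable_imp_integrable square_integrable_nth borel_measurable_nth)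
  then show "mixed_moment M f g = 0"
    by (simp add: vec_eq_iff mixed_moment_nth)
  then show "mixed_moment M g f = 0"
    by (metis transpose_mixed_moment transpose_0)
qed

text \<open>Grouping \<open>f\<close> and \<open>g\<close> into one \<open>H\<close>-measurable
  product lets the scalar split off. The scalar will be one gain noise, or the product of two gain
  noises at the same time.\<close>

lemma mixed_moment_scaleR_indep:
  fixes f :: "'a \<Rightarrow> real^'n" and g :: "'a \<Rightarrow> real^'m"
  assumes "h \<in> borel_measurable G" "integrable M h"
    and "f \<in> borel_measurable H" "g \<in> borel_measurable H"
    and "square_integrable M f" "square_integrable M g"
  shows "mixed_moment M (\<lambda>\<omega>. h \<omega> *\<^sub>R f \<omega>) g = (\<integral>\<omega>. h \<omega> \<partial>M) *\<^sub>R mixed_moment M f g"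
proof -
  have "(\<integral>\<omega>. h \<omega> * (f \<omega> $ i * g \<omega> $ j) \<partial>M) = (\<integral>\<omega>. h \<omega> \<partial>M) * (\<integral>\<omega>. f \<omega> $ i * g \<omega> $ j \<partial>M)" for i j
    by (rule integral_mult_indep)
      (use assms in \<open>auto intro: integrable_mult_nth borel_measurable_times borel_measurable_nth\<close>)
  then show ?thesis
    by (simp add: vec_eq_iff mixed_moment_nth mult.assoc)
qed

end

section \<open>Independence of the noise sources\<close>

lemma generated_events_compose:
  assumes "X \<in> space P \<rightarrow> space K" "g \<in> measurable K L"
  shows "generated_events P L (\<lambda>\<omega>. g (X \<omega>)) \<subseteq> generated_events P K X"
proof
  fix a assume "a \<in> generated_events P L (\<lambda>\<omega>. g (X \<omega>))"
  then obtain E where E: "E \<in> sets L" "a = (\<lambda>\<omega>. g (X \<omega>)) -` E \<inter> space P"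
    by (auto simp: generated_events_def)
  have "a = X -` (g -` E \<inter> space K) \<inter> space P"
    using assms(1) by (auto simp: E)
  then show "a \<in> generated_events P K X"
    using measurable_sets [OF assms(2) E(1)] unfolding generated_events_def by blast
qed

lemma generated_events_Int:
  assumes "a \<in> generated_events P K X" "b \<in> generated_events P K X"
  shows "a \<inter> b \<in> generated_events P K X"
proof -
  obtain E E' where "E \<in> sets K" "E' \<in> sets K" "a = X -` E \<inter> space P" "b = X -` E' \<inter> space P"
    using assms by (auto simp: generated_events_def)
  then have "E \<inter> E' \<in> sets K" "a \<inter> b = X -` (E \<inter> E') \<inter> space P"
    by auto
  then show ?thesis
    unfolding generated_events_def by blast
qed

lemma generated_events_INT:
  fixes n :: nat
  assumes "\<And>k. a k \<in> generated_events P K X"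
  shows "(\<Inter>k\<le>n. a k) \<in> generated_events P K X"
  by (induction n) (auto simp: atMost_Suc assms intro: generated_events_Int)

lemma space_in_generated_events:
  assumes "X \<in> space P \<rightarrow> space K"
  shows "space P \<in> generated_events P K X"
proof -
  have "space P = X -` space K \<inter> space P" using assms by auto
  then show ?thesis unfolding generated_events_def by blast
qed

text \<open>The units of mutual independence. The whole sequence \<open>v\<close> is one source,
  since its members may depend on each other. The gain noises of one time are also bundled, being
  only uncorrelated among themselves.\<close>

datatype source = Exogenous | State_Noise nat | Gain_Noise nat

locale noisy_system =
  fixes P :: "'a measure" and w :: "nat \<Rightarrow> 'a \<Rightarrow> real^'n" and M :: nat
    and \<sigma> :: "nat \<Rightarrow> nat \<Rightarrow> 'a \<Rightarrow> real" and v :: "nat \<Rightarrow> 'a \<Rightarrow> real^'m"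
  assumes noise_model: "noise_model P w M \<sigma>" and exogenous: "exogenous P w M \<sigma> v"
begin

sublocale prob_space P
  using noise_model by (simp add: noise_model_def)

definition source_events :: "source \<Rightarrow> 'a set set" where
  "source_events s = (case s of
     Exogenous \<Rightarrow> generated_events P (Pi\<^sub>M UNIV (\<lambda>_. borel)) (\<lambda>\<omega> k. v k \<omega>)
   | State_Noise k \<Rightarrow> generated_events P borel (w k)
   | Gain_Noise k \<Rightarrow> generated_events P (noise_vec_space M) (noise_vec M \<sigma> k))"

abbreviation state_noise_events where
  "state_noise_events \<equiv> generated_events P (Pi\<^sub>M UNIV (\<lambda>_. borel)) (\<lambda>\<omega> k. w k \<omega>)"

abbreviation gain_noise_events where
  "gain_noise_events \<equiv>
    generated_events P (Pi\<^sub>M UNIV (\<lambda>_. noise_vec_space M)) (\<lambda>\<omega> k. noise_vec M \<sigma> k \<omega>)"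

abbreviation noise_events where
  "noise_events \<equiv> generated_events P
    (Pi\<^sub>M UNIV (\<lambda>_. borel) \<Otimes>\<^sub>M Pi\<^sub>M UNIV (\<lambda>_. noise_vec_space M))
    (\<lambda>\<omega>. (\<lambda>k. w k \<omega>, \<lambda>k. noise_vec M \<sigma> k \<omega>))"

lemma noise_vec_in_space [simp]: "noise_vec M \<sigma> k \<omega> \<in> space (noise_vec_space M)"
  by (simp add: space_PiM)

lemma source_events_State_Noise: "source_events (State_Noise k) \<subseteq> state_noise_events"
  unfolding source_events_def source.case
  by (rule generated_events_compose [where g = "\<lambda>f. f k"]) (auto simp: space_PiM)

lemma source_events_Gain_Noise: "source_events (Gain_Noise k) \<subseteq> gain_noise_events"
  unfolding source_events_def source.case
  by (rule generated_events_compose [where g = "\<lambda>f. f k"]) (auto simp: space_PiM)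

lemma state_noise_events_subset: "state_noise_events \<subseteq> noise_events"
  using generated_events_compose [where g = fst, OF _ measurable_fst,
      of "\<lambda>\<omega>. (\<lambda>k. w k \<omega>, \<lambda>k. noise_vec M \<sigma> k \<omega>)" P "Pi\<^sub>M UNIV (\<lambda>_. borel)"
        "Pi\<^sub>M UNIV (\<lambda>_. noise_vec_space M)"]
  by (simp add: space_pair_measure space_PiM Pi_iff PiE_iff)

lemma gain_noise_events_subset: "gain_noise_events \<subseteq> noise_events"
  using generated_events_compose [where g = snd, OF _ measurable_snd,
      of "\<lambda>\<omega>. (\<lambda>k. w k \<omega>, \<lambda>k. noise_vec M \<sigma> k \<omega>)" P "Pi\<^sub>M UNIV (\<lambda>_. borel)"
        "Pi\<^sub>M UNIV (\<lambda>_. noise_vec_space M)"]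
  by (simp add: space_pair_measure space_PiM Pi_iff PiE_iff)

lemma space_in_source_events: "space P \<in> source_events s"
  by (cases s) (auto simp: source_events_def space_PiM intro!: space_in_generated_events)

lemma indep_exogenous: "indep_set (source_events Exogenous) noise_events"
  using exogenous by (simp add: exogenous_def source_events_def)

lemma indep_noises: "indep_set state_noise_events gain_noise_events"
  using noise_model by (simp add: noise_model_def)

lemma source_events_subset_events: "source_events s \<subseteq> events"
proof (cases s)
  case Exogenous
  then show ?thesis using indep_setD_ev1 [OF indep_exogenous] by simp
next
  case (State_Noise k)
  then show ?thesis
    using source_events_State_Noise [of k] indep_setD_ev1 [OF indep_noises] by simp
next
  case (Gain_Noise k)
  then show ?thesis
    using source_events_Gain_Noise [of k] indep_setD_ev2 [OF indep_noises] by simp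
qed

lemma prob_INT_state_noise:
  assumes "\<And>k. a k \<in> source_events (State_Noise k)"
  shows "prob (\<Inter>k\<le>n. a k) = (\<Prod>k\<le>n. prob (a k))"
proof -
  have "indep_sets (\<lambda>k. {w k -` A \<inter> space P | A. A \<in> sets borel}) UNIV"
    using noise_model by (simp add: noise_model_def indep_vars_def2)
  from indep_setsD [OF this, of "{..n}" a] assms show ?thesis
    by (simp add: source_events_def generated_events_def)
qed

lemma prob_INT_gain_noise:
  assumes "\<And>k. a k \<in> source_events (Gain_Noise k)"
  shows "prob (\<Inter>k\<le>n. a k) = (\<Prod>k\<le>n. prob (a k))"
proof -
  have "indep_sets (\<lambda>k. {noise_vec M \<sigma> k -` A \<inter> space P | A. A \<in> sets (noise_vec_space M)}) UNIV"
    using noise_model by (simp add: noise_model_def indep_vars_def2)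
  from indep_setsD [OF this, of "{..n}" a] assms show ?thesis
    by (simp add: source_events_def generated_events_def)
qed

text \<open>The probability of an intersection is factored in three stages: \<open>v\<close> against
  all noise, state noise against gain noise, and finally each noise sequence over time.\<close>

lemma indep_sources: "indep_sets source_events UNIV"
proof (rule indep_setsI)
  show "source_events s \<subseteq> events" for s
    by (rule source_events_subset_events)
next
  fix A :: "source \<Rightarrow> 'a set" and J
  assume J: "J \<noteq> {}" "finite J" and A: "\<forall>s\<in>J. A s \<in> source_events s"
  \<comment> \<open>Padding with the whole space extends the family to all sources up to a common
    time \<open>n\<close>, in the shape that the three stages require; the added factors have
    probability 1.\<close>
  define A' where "A' s = (if s \<in> J then A s else space P)" for s
  have A': "A' s \<in> source_events s" for s
    using A space_in_source_events by (simp add: A'_def)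
  define ind where "ind s = (case s of Exogenous \<Rightarrow> 0 | State_Noise k \<Rightarrow> k | Gain_Noise k \<Rightarrow> k)" for s
  obtain n where n: "\<And>s. s \<in> J \<Longrightarrow> ind s \<le> n"
    using finite_nat_set_iff_bounded_le [of "ind ` J"] J by auto
  define L where "L = insert Exogenous (State_Noise ` {..n} \<union> Gain_Noise ` {..n})"
  have "s \<in> L" if "s \<in> J" for s
    using n [OF that] by (cases s) (auto simp: L_def ind_def)
  then have JL: "J \<subseteq> L" "finite L" by (auto simp: L_def)
  define S G where "S = (\<Inter>k\<le>n. A' (State_Noise k))" and "G = (\<Inter>k\<le>n. A' (Gain_Noise k))"
  have S: "S \<in> state_noise_events"
    unfolding S_def using A' source_events_State_Noise by (intro generated_events_INT) blast
  have G: "G \<in> gain_noise_events"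
    unfolding G_def using A' source_events_Gain_Noise by (intro generated_events_INT) blast
  \<comment> \<open>Since \<open>J\<close> is nonempty, the left intersection stays inside
    \<open>space P\<close>, so intersecting with the padding changes nothing.\<close>
  have "(\<Inter>s\<in>J. A s) = (\<Inter>s\<in>L. A' s)"
  proof -
    have "A s \<subseteq> space P" if "s \<in> J" for s
      using A source_events_subset_events [of s] that sets.sets_into_space by blast
    moreover obtain s where "s \<in> J" using J(1) by blast
    ultimately have "x \<in> space P" if "x \<in> (\<Inter>s\<in>J. A s)" for x
      using that by blast
    then show ?thesis
      using JL(1) by (auto simp: A'_def)
  qed
  also have "\<dots> = A' Exogenous \<inter> (S \<inter> G)"
    by (auto simp: L_def S_def G_def)
  also have "prob \<dots> = prob (A' Exogenous) * (prob S * prob G)"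
  proof -
    have "S \<inter> G \<in> noise_events"
      using S G state_noise_events_subset gain_noise_events_subset
      by (intro generated_events_Int) blast+
    from indep_setD [OF indep_exogenous A' this] show ?thesis
      by (simp only: indep_setD [OF indep_noises S G])
  qed
  also have "\<dots> = prob (A' Exogenous) *
      ((\<Prod>k\<le>n. prob (A' (State_Noise k))) * (\<Prod>k\<le>n. prob (A' (Gain_Noise k))))"
    unfolding S_def G_def using A' by (simp add: prob_INT_state_noise prob_INT_gain_noise)
  \<comment> \<open>The constructors of \<open>source\<close> are injective with disjoint ranges, so
    the product over \<open>L\<close> splits into these three groups.\<close>
  also have "\<dots> = (\<Prod>s\<in>L. prob (A' s))"
    unfolding L_def
    by (subst prod.insert, simp, force, subst prod.union_disjoint, simp, simp, force,
      simp add: prod.reindex inj_on_def)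
  also have "\<dots> = (\<Prod>s\<in>J. prob (A s))"
    by (rule prod.mono_neutral_cong_right [OF JL(2,1)]) (auto simp: A'_def prob_space)
  finally show "prob (\<Inter>s\<in>J. A s) = (\<Prod>s\<in>J. prob (A s))" .
qed

section \<open>Sigma-algebras generated by sets of sources\<close>

definition info :: "source set \<Rightarrow> 'a measure" where
  "info I = sigma (space P) (\<Union>s\<in>I. source_events s)"

lemma UN_source_events_Pow: "(\<Union>s\<in>I. source_events s) \<subseteq> Pow (space P)"
  using source_events_subset_events sets.sets_into_space by blast

lemma space_info [simp]: "space (info I) = space P"
  by (simp add: info_def UN_source_events_Pow)

lemma sets_info: "sets (info I) = sigma_sets (space P) (\<Union>s\<in>I. source_events s)"
  by (simp add: info_def UN_source_events_Pow)

lemma subalgebra_info: "subalgebra P (info I)"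
  unfolding subalgebra_def sets_info
  using source_events_subset_events by (auto intro!: sets.sigma_sets_subset)

text \<open>Every \<open>source_events s\<close> is stable under intersection, so independence
  passes from these generators to the sigma-algebras of disjoint blocks of sources.\<close>

lemma indep_info:
  assumes "I \<inter> I' = {}"
  shows "indep_subalgebras P (info I) (info I')"
proof
  have "indep_sets (\<lambda>j. sigma_sets (space P) (\<Union>s\<in>case_bool I I' j. source_events s)) UNIV"
  proof (rule indep_sets_collect_sigma)
    show "indep_sets source_events (\<Union>j\<in>UNIV. case_bool I I' j)"
      by (rule indep_sets_mono_index [OF _ indep_sources]) simp
    show "Int_stable (source_events s)" for s
      by (cases s) (auto simp: Int_stable_def source_events_def intro: generated_events_Int)
    show "disjoint_family_on (case_bool I I') UNIV"
      using assms by (auto simp: disjoint_family_on_def split: bool.splits)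
  qed
  then show "indep_set (sets (info I)) (sets (info I'))"
    unfolding indep_set_def sets_info
    by (rule back_subst [of "\<lambda>F. indep_sets F UNIV"]) (auto simp: fun_eq_iff split: bool.split)
qed (rule subalgebra_info)+

lemma measurable_info:
  assumes "s \<in> I" "source_events s = generated_events P K X" "X \<in> space P \<rightarrow> space K"
  shows "X \<in> measurable (info I) K"
proof (rule measurableI)
  fix E assume "E \<in> sets K"
  then have "X -` E \<inter> space P \<in> source_events s"
    unfolding assms(2) generated_events_def by blast
  then show "X -` E \<inter> space (info I) \<in> sets (info I)"
    using assms(1) by (auto simp: sets_info)
qed (use assms(3) in auto)

lemma measurable_info_v:
  assumes "Exogenous \<in> I"
  shows "v k \<in> borel_measurable (info I)"
proof -
  have "(\<lambda>\<omega> k. v k \<omega>) \<in> measurable (info I) (Pi\<^sub>M UNIV (\<lambda>_. borel))"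
    by (rule measurable_info [OF assms]) (auto simp: source_events_def space_PiM)
  from measurable_compose [OF this measurable_component_singleton [of k]] show ?thesis
    by simp
qed

lemma measurable_info_w:
  assumes "State_Noise k \<in> I"
  shows "w k \<in> borel_measurable (info I)"
  by (rule measurable_info [OF assms]) (auto simp: source_events_def)

lemma measurable_info_\<sigma>:
  assumes "Gain_Noise k \<in> I" "i \<in> {1..M}"
  shows "\<sigma> k i \<in> borel_measurable (info I)"
proof -
  have "noise_vec M \<sigma> k \<in> measurable (info I) (noise_vec_space M)"
    by (rule measurable_info [OF assms(1)]) (auto simp: source_events_def space_PiM)
  from measurable_compose [OF this measurable_component_singleton [OF assms(2)]] show ?thesis
    using assms(2) by simp
qed

end

section \<open>Closed-loop dynamics\<close>

context noisy_system
begin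

lemma info_mono:
  assumes "I \<subseteq> I'" "f \<in> measurable (info I) K"
  shows "f \<in> measurable (info I') K"
proof (rule measurable_from_subalg [OF _ assms(2)])
  show "subalgebra (info I') (info I)"
    using assms(1) unfolding subalgebra_def sets_info by (simp add: sigma_sets_mono' UN_mono)
qed

lemma measurable_of_info: "f \<in> measurable (info I) K \<Longrightarrow> f \<in> measurable P K"
  by (rule measurable_from_subalg [OF subalgebra_info])

text \<open>All of \<open>v\<close>, future values included, counts as past. This is sound because
  \<open>v\<close> is independent of all noise, and it allows moments of the state against later
  \<open>v l\<close>. Noise of time \<open>k\<close> is left out, as it first enters the state at
  time \<open>Suc k\<close>.\<close>

definition past :: "nat \<Rightarrow> source set" where
  "past k = insert Exogenous (State_Noise ` {..<k} \<union> Gain_Noise ` {..<k})"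

lemma past_mono: "j \<le> k \<Longrightarrow> past j \<subseteq> past k"
  by (auto simp: past_def)

lemma square_integrable_w: "square_integrable P (w k)"
  using noise_model by (simp add: noise_model_def)

lemma square_integrable_\<sigma>: "i \<in> {1..M} \<Longrightarrow> square_integrable P (\<sigma> k i)"
  using noise_model by (simp add: noise_model_def)

lemma integral_w: "(\<integral>\<omega>. w k \<omega> \<partial>P) = 0"
  using noise_model by (simp add: noise_model_def)

lemma integral_\<sigma>: "i \<in> {1..M} \<Longrightarrow> (\<integral>\<omega>. \<sigma> k i \<omega> \<partial>P) = 0"
  using noise_model by (simp add: noise_model_def)

lemma integral_\<sigma>_\<sigma>:
  "i \<in> {1..M} \<Longrightarrow> j \<in> {1..M} \<Longrightarrow> (\<integral>\<omega>. \<sigma> k i \<omega> * \<sigma> k j \<omega> \<partial>P) = (if i = j then 1 else 0)"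
  using noise_model by (simp add: noise_model_def)

lemma mixed_moment_w_w: "mixed_moment P (w k) (w k) = mat 1"
  using noise_model by (simp add: noise_model_def)

section \<open>One step of the dynamics from an arbitrary state and input determined by the
  past\<close>

context
  fixes x :: "'a \<Rightarrow> real^'n" and u :: "'a \<Rightarrow> real^'k" and k :: nat
    and A :: "real^'n^'n" and B :: "real^'k^'n" and Am :: "nat \<Rightarrow> real^'n^'n"
  assumes x: "x \<in> borel_measurable (info (past k))" "square_integrable P x"
    and u: "u \<in> borel_measurable (info (past k))" "square_integrable P u"
begin

definition drift where "drift \<omega> = hcat A B *v vcat (x \<omega>) (u \<omega>)"
definition shock where "shock i \<omega> = \<sigma> k i \<omega> *\<^sub>R (Am i *v x \<omega>)"

text \<open>The drift is determined by the past, the shocks carry the fresh centred gain noise, and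
  \<open>w k\<close> is centred and independent of both. With the pieces separated in this way, all
  cross moments between them vanish.\<close>

lemma next_state_eq:
  "(A + (\<Sum>i\<in>{1..M}. \<sigma> k i \<omega> *\<^sub>R Am i)) *v x \<omega> + B *v u \<omega> + w k \<omega> =
    drift \<omega> + (\<Sum>i\<in>{1..M}. shock i \<omega>) + w k \<omega>"
proof -
  have "(\<Sum>i\<in>{1..M}. \<sigma> k i \<omega> *\<^sub>R Am i) *v x \<omega> = (\<Sum>i\<in>{1..M}. shock i \<omega>)"
    by (simp add: shock_def matrix_vector_mult_sum_rdistrib scaleR_matrix_vector_assoc)
  then show ?thesis
    by (simp add: drift_def hcat_mult_vcat matrix_vector_mult_add_rdistrib)
qed

interpretation \<sigma>: indep_subalgebras P "info {Gain_Noise k}" "info (past k)"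
  by (rule indep_info) (auto simp: past_def)

text \<open>The gain noise of time \<open>k\<close> joins the past here, because \<open>w k\<close>
  must be independent of the shocks as well as of the drift.\<close>

interpretation w: indep_subalgebras P "info {State_Noise k}" "info (insert (Gain_Noise k) (past k))"
  by (rule indep_info) (auto simp: past_def)

lemma drift: "drift \<in> borel_measurable (info (past k))" "square_integrable P drift"
  unfolding drift_def [abs_def]
  by (intro measurable_mult_vec measurable_vcat square_integrable_mult_vec square_integrable_vcat x u)+

lemma scaled_state:
  "(\<lambda>\<omega>. Am i *v x \<omega>) \<in> borel_measurable (info (past k))"
  "square_integrable P (\<lambda>\<omega>. Am i *v x \<omega>)"
  by (intro measurable_mult_vec square_integrable_mult_vec x)+

lemma \<sigma>_info: "i \<in> {1..M} \<Longrightarrow> \<sigma> k i \<in> borel_measurable (info {Gain_Noise k})"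
  by (rule measurable_info_\<sigma>) auto

lemma square_integrable_shock: "i \<in> {1..M} \<Longrightarrow> square_integrable P (shock i)"
  unfolding shock_def [abs_def]
  by (intro \<sigma>.square_integrable_scaleR_indep \<sigma>_info scaled_state square_integrable_\<sigma>)

lemma measurable_shock:
  "i \<in> {1..M} \<Longrightarrow> shock i \<in> borel_measurable (info (insert (Gain_Noise k) (past k)))"
  unfolding shock_def [abs_def]
  by (intro borel_measurable_scaleR measurable_info_\<sigma> info_mono [OF _ scaled_state(1)]) auto

lemma mixed_moment_shock_past:
  fixes g :: "'a \<Rightarrow> real^'l"
  assumes "i \<in> {1..M}" "g \<in> borel_measurable (info (past k))" "square_integrable P g"
  shows "mixed_moment P (shock i) g = 0" "mixed_moment P g (shock i) = 0"
proof -
  show "mixed_moment P (shock i) g = 0"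
    unfolding shock_def [abs_def]
    using \<sigma>.mixed_moment_scaleR_indep [OF \<sigma>_info [OF assms(1)] square_integrable_imp_integrable
        [OF square_integrable_\<sigma> [OF assms(1)]] scaled_state(1) assms(2) scaled_state(2) assms(3)]
      integral_\<sigma> [OF assms(1)] by simp
  then show "mixed_moment P g (shock i) = 0"
    by (metis transpose_mixed_moment transpose_0)
qed

text \<open>Both scalars are gathered into
  \<open>\<sigma> k i \<omega> * \<sigma> k j \<omega>\<close>, a function of the single source
  \<open>Gain_Noise k\<close>. Its expectation is known although the gain noises of one time are
  just uncorrelated.\<close>

lemma mixed_moment_shock_shock:
  assumes i: "i \<in> {1..M}" and j: "j \<in> {1..M}"
  shows "mixed_moment P (shock i) (shock j) =
    (if i = j then Am i ** mixed_moment P x x ** transpose (Am i) else 0)"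
proof -
  have "mixed_moment P (shock i) (shock j) =
      mixed_moment P (\<lambda>\<omega>. (\<sigma> k i \<omega> * \<sigma> k j \<omega>) *\<^sub>R (Am i *v x \<omega>)) (\<lambda>\<omega>. Am j *v x \<omega>)"
    by (simp add: vec_eq_iff mixed_moment_nth shock_def mult_ac)
  also have "\<dots> = (\<integral>\<omega>. \<sigma> k i \<omega> * \<sigma> k j \<omega> \<partial>P) *\<^sub>R mixed_moment P (\<lambda>\<omega>. Am i *v x \<omega>) (\<lambda>\<omega>. Am j *v x \<omega>)"
    by (intro \<sigma>.mixed_moment_scaleR_indep borel_measurable_times \<sigma>_info i j scaled_state
        integrable_mult_square_integrable square_integrable_\<sigma>)
  also have "mixed_moment P (\<lambda>\<omega>. Am i *v x \<omega>) (\<lambda>\<omega>. Am j *v x \<omega>) =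
      Am i ** mixed_moment P x x ** transpose (Am j)"
    by (simp add: mixed_moment_mult_left mixed_moment_mult_right x square_integrable_mult_vec matrix_mul_assoc)
  finally show ?thesis
    using integral_\<sigma>_\<sigma> [OF i j] by simp
qed

lemma mixed_moment_w_before:
  fixes g :: "'a \<Rightarrow> real^'l"
  assumes "g \<in> borel_measurable (info (insert (Gain_Noise k) (past k)))" "square_integrable P g"
  shows "mixed_moment P (w k) g = 0" "mixed_moment P g (w k) = 0"
  using w.mixed_moment_indep_eq_0 [OF measurable_info_w assms(1) square_integrable_w assms(2) integral_w]
  by auto

lemma info_past_mono:
  "f \<in> measurable (info (past k)) K \<Longrightarrow> f \<in> measurable (info (insert (Gain_Noise k) (past k))) K"
  by (erule info_mono [rotated]) auto

lemma square_integrable_sum_shock: "square_integrable P (\<lambda>\<omega>. \<Sum>i\<in>{1..M}. shock i \<omega>)"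
  by (intro square_integrable_sum square_integrable_shock)

lemma square_integrable_next_state:
  "square_integrable P (\<lambda>\<omega>. (A + (\<Sum>i\<in>{1..M}. \<sigma> k i \<omega> *\<^sub>R Am i)) *v x \<omega> + B *v u \<omega> + w k \<omega>)"
  unfolding next_state_eq
  by (intro square_integrable_add square_integrable_sum_shock drift square_integrable_w)

text \<open>Shocks and \<open>w k\<close> are orthogonal to the past, so only the drift contributes.
  Taking \<open>g\<close> to be a later \<open>v l\<close> propagates the orthogonality of the state
  to the input randomisation.\<close>

lemma mixed_moment_next_state_past:
  fixes g :: "'a \<Rightarrow> real^'l"
  assumes g: "g \<in> borel_measurable (info (past k))" "square_integrable P g"
  shows "mixed_moment P
      (\<lambda>\<omega>. (A + (\<Sum>i\<in>{1..M}. \<sigma> k i \<omega> *\<^sub>R Am i)) *v x \<omega> + B *v u \<omega> + w k \<omega>) g =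
    A ** mixed_moment P x g + B ** mixed_moment P u g"
proof -
  have "mixed_moment P drift g = A ** mixed_moment P x g + B ** mixed_moment P u g"
    unfolding drift_def [abs_def] hcat_mult_vcat
    by (simp add: mixed_moment_add_left mixed_moment_mult_left square_integrable_mult_vec x u g)
  moreover have "mixed_moment P (\<lambda>\<omega>. \<Sum>i\<in>{1..M}. shock i \<omega>) g =
      (\<Sum>i\<in>{1..M}. mixed_moment P (shock i) g)"
    by (intro mixed_moment_sum_left square_integrable_shock g)
  moreover have "\<dots> = 0"
    by (intro sum.neutral ballI mixed_moment_shock_past g)
  moreover have "mixed_moment P (w k) g = 0"
    by (intro mixed_moment_w_before info_past_mono g)
  ultimately show ?thesis
    unfolding next_state_eq
    by (simp add: mixed_moment_add_left square_integrable_add square_integrable_sum_shock drift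
        square_integrable_w g del: One_nat_def)
qed

text \<open>One term per piece of the decomposition: the drift gives the congruence with
  \<open>hcat A B\<close>, the diagonal pairs of shocks give the sum, and \<open>w k\<close> gives
  the identity. State and input enter just as square integrable functions of the past, so nonlinear
  controllers are included.\<close>

lemma mixed_moment_next_state:
  fixes x' :: "'a \<Rightarrow> real^'n"
  defines "x' \<equiv> \<lambda>\<omega>. (A + (\<Sum>i\<in>{1..M}. \<sigma> k i \<omega> *\<^sub>R Am i)) *v x \<omega> + B *v u \<omega> + w k \<omega>"
  defines "y \<equiv> \<lambda>\<omega>. vcat (x \<omega>) (u \<omega>)"
  shows "mixed_moment P x' x' = hcat A B ** mixed_moment P y y ** transpose (hcat A B) +
    (\<Sum>i\<in>{1..M}. Am i ** mixed_moment P x x ** transpose (Am i)) + mat 1"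
proof -
  let ?s = "\<lambda>\<omega>. \<Sum>i\<in>{1..M}. shock i \<omega>"
  have s: "square_integrable P ?s" "?s \<in> borel_measurable (info (insert (Gain_Noise k) (past k)))"
    by (intro square_integrable_sum_shock borel_measurable_sum measurable_shock; assumption)+
  have ds: "square_integrable P (\<lambda>\<omega>. drift \<omega> + ?s \<omega>)"
    "(\<lambda>\<omega>. drift \<omega> + ?s \<omega>) \<in> borel_measurable (info (insert (Gain_Noise k) (past k)))"
    by (intro square_integrable_add borel_measurable_add s drift info_past_mono)+
  have "mixed_moment P drift drift = hcat A B ** mixed_moment P y y ** transpose (hcat A B)"
    unfolding drift_def [abs_def] y_def
    by (simp add: mixed_moment_mult_left mixed_moment_mult_right square_integrable_vcat
        square_integrable_mult_vec x u matrix_mul_assoc)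
  moreover have "mixed_moment P drift ?s = (\<Sum>i\<in>{1..M}. mixed_moment P drift (shock i))"
    by (intro mixed_moment_sum_right square_integrable_shock drift)
  moreover have "\<dots> = 0"
    by (intro sum.neutral ballI mixed_moment_shock_past drift)
  moreover have "mixed_moment P ?s drift = (\<Sum>i\<in>{1..M}. mixed_moment P (shock i) drift)"
    by (intro mixed_moment_sum_left square_integrable_shock drift)
  moreover have "\<dots> = 0"
    by (intro sum.neutral ballI mixed_moment_shock_past drift)
  moreover have "mixed_moment P ?s ?s = (\<Sum>i\<in>{1..M}. Am i ** mixed_moment P x x ** transpose (Am i))"
  proof -
    have "mixed_moment P ?s ?s = (\<Sum>i\<in>{1..M}. \<Sum>j\<in>{1..M}. mixed_moment P (shock i) (shock j))"
      by (subst mixed_moment_sum_left [OF square_integrable_shock s(1)], assumption,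
        intro sum.cong refl mixed_moment_sum_right square_integrable_shock)
    also have "\<dots> = (\<Sum>i\<in>{1..M}. \<Sum>j\<in>{1..M}.
        if i = j then Am i ** mixed_moment P x x ** transpose (Am i) else 0)"
      by (intro sum.cong refl mixed_moment_shock_shock)
    finally show ?thesis by simp
  qed
  ultimately have "mixed_moment P (\<lambda>\<omega>. drift \<omega> + ?s \<omega>) (\<lambda>\<omega>. drift \<omega> + ?s \<omega>) =
      hcat A B ** mixed_moment P y y ** transpose (hcat A B) +
      (\<Sum>i\<in>{1..M}. Am i ** mixed_moment P x x ** transpose (Am i))"
    using drift(2) s(1) ds(1)
    by (simp only: mixed_moment_add_left mixed_moment_add_right add_0_right add_0_left)
  moreover have "mixed_moment P x' x' =
      mixed_moment P (\<lambda>\<omega>. drift \<omega> + ?s \<omega>) (\<lambda>\<omega>. drift \<omega> + ?s \<omega>) + mat 1"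
  proof -
    have "mixed_moment P (\<lambda>\<omega>. d \<omega> + w k \<omega>) (\<lambda>\<omega>. d \<omega> + w k \<omega>) = mixed_moment P d d + mat 1"
      if "square_integrable P d" "d \<in> borel_measurable (info (insert (Gain_Noise k) (past k)))" for d
      using that mixed_moment_w_before [OF that(2,1)]
      by (simp add: mixed_moment_add_left mixed_moment_add_right square_integrable_add
          square_integrable_w mixed_moment_w_w)
    from this [OF ds] show ?thesis
      unfolding x'_def next_state_eq .
  qed
  ultimately show ?thesis by simp
qed

end

text \<open>Controllers are constrained at times before \<open>N\<close>, which determine states up
  to and including \<open>N\<close>. Strong induction is used because the input at time
  \<open>k\<close> depends on the whole history of states.\<close>

lemma measurable_state_input:
  assumes \<mu>: "\<And>k. k < N \<Longrightarrow>
    (\<lambda>(h, r). \<mu> k h r) \<in> borel_measurable (Pi\<^sub>M {..k} (\<lambda>_. borel) \<Otimes>\<^sub>M borel)"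
  shows measurable_state:
      "k \<le> N \<Longrightarrow> state A B M Am w \<sigma> \<mu> v k \<in> borel_measurable (info (past k))"
    and measurable_input:
      "k < N \<Longrightarrow> input A B M Am w \<sigma> \<mu> v k \<in> borel_measurable (info (past k))"
proof -
  have input: "input A B M Am w \<sigma> \<mu> v k \<in> borel_measurable (info (past k))"
    if "k < N" and state: "\<And>t. t \<le> k \<Longrightarrow> state A B M Am w \<sigma> \<mu> v t \<in> borel_measurable (info (past t))"
    for k
  proof -
    have "(\<lambda>\<omega>. \<lambda>t\<in>{..k}. state A B M Am w \<sigma> \<mu> v t \<omega>) \<in>
        measurable (info (past k)) (Pi\<^sub>M {..k} (\<lambda>_. borel))"
      by (intro measurable_restrict info_mono [OF past_mono state]) auto
    moreover have "v k \<in> borel_measurable (info (past k))"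
      by (rule measurable_info_v) (simp add: past_def)
    ultimately have "(\<lambda>\<omega>. (\<lambda>t\<in>{..k}. state A B M Am w \<sigma> \<mu> v t \<omega>, v k \<omega>)) \<in>
        measurable (info (past k)) (Pi\<^sub>M {..k} (\<lambda>_. borel) \<Otimes>\<^sub>M borel)"
      by (rule measurable_Pair)
    from measurable_compose [OF this \<mu> [OF that(1)]] show ?thesis
      by (simp add: input_def [abs_def])
  qed
  show state: "state A B M Am w \<sigma> \<mu> v k \<in> borel_measurable (info (past k))" if "k \<le> N" for k
    using that
  proof (induction k rule: less_induct)
    case (less k)
    show ?case
    proof (cases k)
      case 0
      then have "state A B M Am w \<sigma> \<mu> v k = (\<lambda>_. 0)" by (simp add: fun_eq_iff)
      then show ?thesis by simp
    next
      case (Suc j)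
      have x: "state A B M Am w \<sigma> \<mu> v j \<in> borel_measurable (info (past k))"
        using less Suc by (intro info_mono [OF past_mono less.IH]) auto
      have "input A B M Am w \<sigma> \<mu> v j \<in> borel_measurable (info (past j))"
        using less Suc by (intro input) auto
      then have u: "input A B M Am w \<sigma> \<mu> v j \<in> borel_measurable (info (past k))"
        by (rule info_mono [OF past_mono, rotated]) (simp add: Suc)
      have w: "w j \<in> borel_measurable (info (past k))"
        by (rule measurable_info_w) (auto simp: past_def Suc)
      have \<sigma>: "\<sigma> j i \<in> borel_measurable (info (past k))" if "i \<in> {1..M}" for i
        by (rule measurable_info_\<sigma> [OF _ that]) (auto simp: past_def Suc)
      have "state A B M Am w \<sigma> \<mu> v k = (\<lambda>\<omega>. A *v state A B M Am w \<sigma> \<mu> v j \<omega>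
          + (\<Sum>i\<in>{1..M}. \<sigma> j i \<omega> *\<^sub>R (Am i *v state A B M Am w \<sigma> \<mu> v j \<omega>))
          + B *v input A B M Am w \<sigma> \<mu> v j \<omega> + w j \<omega>)"
        by (simp add: Suc fun_eq_iff input_def matrix_vector_mult_add_rdistrib
            matrix_vector_mult_sum_rdistrib scaleR_matrix_vector_assoc)
      also have "\<dots> \<in> borel_measurable (info (past k))"
        by (intro borel_measurable_add borel_measurable_sum borel_measurable_scaleR
            measurable_mult_vec x u w \<sigma>)
      finally show ?thesis .
    qed
  qed
  show "input A B M Am w \<sigma> \<mu> v k \<in> borel_measurable (info (past k))" if "k < N" for k
    using that by (intro input state) auto
qed

end

section \<open>The combined state-input vector and its cost\<close>

definition joint where
  "joint A B M Am w \<sigma> \<mu> v k \<omega> =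
    vcat (state A B M Am w \<sigma> \<mu> v k \<omega>) (input A B M Am w \<sigma> \<mu> v k \<omega>)"

lemma F_mat_mult_joint: "F_mat *v joint A B M Am w \<sigma> \<mu> v k \<omega> = state A B M Am w \<sigma> \<mu> v k \<omega>"
  by (simp add: joint_def F_mat_mult_vcat)

lemma input_eq_mult_joint:
  "input A B M Am w \<sigma> \<mu> v k \<omega> = hcat 0 (mat 1) *v joint A B M Am w \<sigma> \<mu> v k \<omega>"
  by (simp add: joint_def hcat_mult_vcat)

lemma output_eq_mult_joint:
  "C *v state A B M Am w \<sigma> \<mu> v k \<omega> + D *v input A B M Am w \<sigma> \<mu> v k \<omega> =
    hcat C D *v joint A B M Am w \<sigma> \<mu> v k \<omega>"
  by (simp add: joint_def hcat_mult_vcat)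

lemma state_Suc:
  "state A B M Am w \<sigma> \<mu> v (Suc k) =
    (\<lambda>\<omega>. (A + (\<Sum>i\<in>{1..M}. \<sigma> k i \<omega> *\<^sub>R Am i)) *v state A B M Am w \<sigma> \<mu> v k \<omega>
      + B *v input A B M Am w \<sigma> \<mu> v k \<omega> + w k \<omega>)"
  by (simp add: fun_eq_iff input_def)

lemma control_feasible_iff_joint:
  "control_feasible N P A B M Am w \<sigma> J Q \<gamma> \<mu> v \<longleftrightarrow> admissible N P w M \<sigma> \<mu> v \<and>
    (\<forall>j\<in>{1..J}. \<forall>k<N. integrable P (\<lambda>\<omega>. joint A B M Am w \<sigma> \<mu> v k \<omega> \<bullet> (Q j *v joint A B M Am w \<sigma> \<mu> v k \<omega>)) \<and>
      (\<integral>\<omega>. joint A B M Am w \<sigma> \<mu> v k \<omega> \<bullet> (Q j *v joint A B M Am w \<sigma> \<mu> v k \<omega>) \<partial>P) \<le> \<gamma> j k)"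
  unfolding control_feasible_def Let_def joint_def ..

lemma square_integrable_state:
  assumes "square_integrable P (joint A B M Am w \<sigma> \<mu> v k)"
  shows "square_integrable P (state A B M Am w \<sigma> \<mu> v k)"
  using square_integrable_mult_vec [OF assms, of F_mat] by (simp add: F_mat_mult_joint)

lemma square_integrable_input:
  assumes "square_integrable P (joint A B M Am w \<sigma> \<mu> v k)"
  shows "square_integrable P (input A B M Am w \<sigma> \<mu> v k)"
  using square_integrable_mult_vec [OF assms, of "hcat 0 (mat 1)"]
  by (simp flip: input_eq_mult_joint)

text \<open>Square integrability makes every summand a finite nonnegative real, namely the trace of
  a congruence of the moment, so the conversion to extended reals commutes with summing and scaling.
  This serves both the optimal controller and its competitors.\<close>

lemma control_cost_eq_sdp_objective:
  assumes N: "N > 0" and L2: "\<And>k. k < N \<Longrightarrow> square_integrable P (joint A B M Am w \<sigma> \<mu> v k)"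
  shows "control_cost N P A B M Am C D w \<sigma> \<mu> v = ennreal (sdp_objective N C D
    (\<lambda>k. mixed_moment P (joint A B M Am w \<sigma> \<mu> v k) (joint A B M Am w \<sigma> \<mu> v k)))"
proof -
  let ?y = "joint A B M Am w \<sigma> \<mu> v"
  define t where "t k = trace (hcat C D ** mixed_moment P (?y k) (?y k) ** transpose (hcat C D))" for k
  have t: "(\<integral>\<^sup>+\<omega>. ennreal ((hcat C D *v ?y k \<omega>) \<bullet> (hcat C D *v ?y k \<omega>)) \<partial>P) = ennreal (t k)"
    "t k \<ge> 0" if "k < N" for k
  proof -
    note z = square_integrable_mult_vec [OF L2 [OF that], of "hcat C D"]
    have *: "t k = (\<integral>\<omega>. (hcat C D *v ?y k \<omega>) \<bullet> (hcat C D *v ?y k \<omega>) \<partial>P)"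
      unfolding t_def mixed_moment_congruence [OF L2 [OF that], symmetric]
      by (rule trace_mixed_moment [OF z z])
    show "t k \<ge> 0" unfolding * by simp
    show "(\<integral>\<^sup>+\<omega>. ennreal ((hcat C D *v ?y k \<omega>) \<bullet> (hcat C D *v ?y k \<omega>)) \<partial>P) = ennreal (t k)"
      unfolding * by (rule nn_integral_eq_integral [OF integrable_inner_square_integrable [OF z z]]) simp
  qed
  have "control_cost N P A B M Am C D w \<sigma> \<mu> v = ennreal (1 / real N) * (\<Sum>k<N. ennreal (t k))"
    by (simp add: control_cost_def output_eq_mult_joint t Let_def)
  also have "\<dots> = ennreal (1 / real N * (\<Sum>k<N. t k))"
  proof -
    have "(\<Sum>k<N. ennreal (t k)) = ennreal (\<Sum>k<N. t k)"
      by (rule sum_ennreal) (simp add: t(2))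
    moreover have "0 \<le> (\<Sum>k<N. t k)"
      by (rule sum_nonneg) (simp add: t(2))
    ultimately show ?thesis
      by (simp add: ennreal_mult [symmetric])
  qed
  finally show ?thesis
    by (simp add: sdp_objective_def t_def)
qed

section \<open>From controllers to feasible points, and from a feasible point to a linear
  controller\<close>

context noisy_system
begin

text \<open>This is the lower-bound direction: \<open>F_mat\<close> extracts the state moment, whose
  recursion was computed from independence alone, and the trace bounds are the control constraints
  rewritten.\<close>

lemma sdp_feasible_joint_moment:
  fixes \<mu> :: "('n, 'm) policy"
  assumes cf: "control_feasible N P A B M Am w \<sigma> J Q \<gamma> \<mu> v"
    and L2: "\<And>k. k < N \<Longrightarrow> square_integrable P (joint A B M Am w \<sigma> \<mu> v k)" and "N > 0"
  shows "sdp_feasible N A B M Am J Q \<gamma>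
    (\<lambda>k. mixed_moment P (joint A B M Am w \<sigma> \<mu> v k) (joint A B M Am w \<sigma> \<mu> v k))"
proof -
  let ?x = "state A B M Am w \<sigma> \<mu> v" and ?u = "input A B M Am w \<sigma> \<mu> v"
    and ?y = "joint A B M Am w \<sigma> \<mu> v"
  have meas: "?x k \<in> borel_measurable (info (past k))" "?u k \<in> borel_measurable (info (past k))"
    if "k < N" for k
    using measurable_state [of N \<mu>] measurable_input [of N \<mu>] cf that
    by (auto simp: control_feasible_def admissible_def)
  have X: "F_mat ** mixed_moment P (?y k) (?y k) ** transpose F_mat = mixed_moment P (?x k) (?x k)"
    if "k < N" for k
    unfolding mixed_moment_congruence [OF L2 [OF that], symmetric] F_mat_mult_joint ..
  have "mixed_moment P (?x (Suc k)) (?x (Suc k)) =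
      hcat A B ** mixed_moment P (?y k) (?y k) ** transpose (hcat A B)
      + (\<Sum>i\<in>{1..M}. Am i ** mixed_moment P (?x k) (?x k) ** transpose (Am i)) + mat 1"
    if "Suc k < N" for k
    unfolding state_Suc joint_def [abs_def]
    by (intro mixed_moment_next_state meas square_integrable_state square_integrable_input L2
        Suc_lessD [OF that])
  moreover have "trace (Q j ** mixed_moment P (?y k) (?y k)) \<le> \<gamma> j k" if "j \<in> {1..J}" "k < N" for j k
  proof -
    have "(\<integral>\<omega>. ?y k \<omega> \<bullet> (Q j *v ?y k \<omega>) \<partial>P) \<le> \<gamma> j k"
      by (rule cf [unfolded control_feasible_iff_joint, THEN conjunct2, rule_format, OF that, THEN conjunct2])
    then show ?thesis
      by (simp only: integral_quadratic_form(2) [OF L2 [OF that(2)]])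
  qed
  moreover have "mixed_moment P (?x 0) (?x 0) = 0"
    by (simp add: vec_eq_iff mixed_moment_nth)
  ultimately show ?thesis
    using X \<open>N > 0\<close> L2
    by (simp add: sdp_feasible_def pos_semidef_mixed_moment flip: matrix_mul_assoc)
qed

text \<open>Feasibility alone gives no control of the second moment, since the \<open>Q j\<close>
  may be indefinite. Finite cost makes the output square integrable, and \<open>hcat C D\<close>
  being bounded below transfers this to state and input.\<close>

lemma square_integrable_joint_of_finite_cost:
  fixes \<mu> :: "('n, 'm) policy"
  assumes "admissible N P w M \<sigma> \<mu> v" and cost: "control_cost N P A B M Am C D w \<sigma> \<mu> v < \<top>"
    and "pos_def (transpose (hcat C D) ** hcat C D)" and k: "k < N"
  shows "square_integrable P (joint A B M Am w \<sigma> \<mu> v k)"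
proof -
  let ?y = "joint A B M Am w \<sigma> \<mu> v k"
  have y: "?y \<in> borel_measurable P"
    unfolding joint_def [abs_def]
    using measurable_state [of N \<mu>] measurable_input [of N \<mu>] assms(1) k
    by (intro measurable_vcat measurable_of_info [of _ "past k"]) (auto simp: admissible_def)
  obtain c where c: "c > 0" "\<And>y. c * norm y \<le> norm (hcat C D *v y)"
    using pos_def_gram_bounded_below [OF assms(3)] by blast
  \<comment> \<open>A zero weight could hide an infinite sum, because zero times infinity is zero in
    \<open>ennreal\<close>; \<open>k < N\<close> excludes this.\<close>
  have "ennreal (1 / real N) \<noteq> 0" using k by simp
  with cost have "(\<Sum>k<N. \<integral>\<^sup>+\<omega>. ennreal ((hcat C D *v joint A B M Am w \<sigma> \<mu> v k \<omega>) \<bullet>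
      (hcat C D *v joint A B M Am w \<sigma> \<mu> v k \<omega>)) \<partial>P) < \<top>"
    by (auto simp: control_cost_def output_eq_mult_joint Let_def ennreal_mult_less_top)
  then have "(\<integral>\<^sup>+\<omega>. ennreal ((hcat C D *v ?y \<omega>) \<bullet> (hcat C D *v ?y \<omega>)) \<partial>P) < \<top>"
    using k by (simp add: ennreal_sum_less_top)
  then have "integrable P (\<lambda>\<omega>. (norm (hcat C D *v ?y \<omega>))\<^sup>2)"
    using measurable_mult_vec [OF y, of "hcat C D"]
    by (intro integrableI_nonneg) (auto simp: power2_norm_eq_inner)
  then have "square_integrable P (\<lambda>\<omega>. hcat C D *v ?y \<omega>)"
    using measurable_mult_vec [OF y] by (simp add: square_integrable_def)
  from this y show ?thesis
    by (rule square_integrable_bound [where c = "1 / c"]) (use c in \<open>simp add: field_simps\<close>)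
qed

text \<open>With \<open>K k ** X k = transpose (R k)\<close> the input has the prescribed cross
  moment with the state. The linear part contributes \<open>K k ** R k\<close> to the input moment,
  and the randomisation, orthogonal to the state, supplies the missing Schur complement.\<close>

lemma joint_moment_linear_controller:
  fixes K :: "nat \<Rightarrow> real^'n^'m" and R :: "nat \<Rightarrow> real^'m^'n" and A :: "real^'n^'n"
  defines "\<mu> \<equiv> \<lambda>k x r. K k *v x k + r"
  assumes V: "\<And>k. k < N \<Longrightarrow> pos_semidef (block (X k) (R k) (transpose (R k)) (U k))"
    and K: "\<And>k. k < N \<Longrightarrow> K k ** X k = transpose (R k)"
    and X0: "X 0 = 0"
    and X_Suc: "\<And>k. Suc k < N \<Longrightarrow> X (Suc k) =
      hcat A B ** block (X k) (R k) (transpose (R k)) (U k) ** transpose (hcat A B)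
      + (\<Sum>i\<in>{1..M}. Am i ** X k ** transpose (Am i)) + mat 1"
    and v: "\<And>k. k < N \<Longrightarrow> square_integrable P (v k)"
    and vv: "\<And>k l. k < N \<Longrightarrow> l < N \<Longrightarrow>
      mixed_moment P (v k) (v l) = (if k = l then U k - K k ** R k else 0)"
    and \<mu>: "\<And>k. k < N \<Longrightarrow>
      (\<lambda>(h, r). \<mu> k h r) \<in> borel_measurable (Pi\<^sub>M {..k} (\<lambda>_. borel) \<Otimes>\<^sub>M borel)"
    and "k < N"
  shows "square_integrable P (joint A B M Am w \<sigma> \<mu> v k)"
    and "mixed_moment P (joint A B M Am w \<sigma> \<mu> v k) (joint A B M Am w \<sigma> \<mu> v k) =
      block (X k) (R k) (transpose (R k)) (U k)"
proof -
  let ?x = "state A B M Am w \<sigma> \<mu> v" and ?u = "input A B M Am w \<sigma> \<mu> v"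
    and ?y = "joint A B M Am w \<sigma> \<mu> v"
  have u: "?u k = (\<lambda>\<omega>. K k *v ?x k \<omega> + v k \<omega>)" for k
    by (simp add: fun_eq_iff input_def \<mu>_def)
  have y: "square_integrable P (?u k)" "square_integrable P (?y k)"
    "mixed_moment P (?y k) (?y k) = block (X k) (R k) (transpose (R k)) (U k)"
    if k: "k < N" and x: "square_integrable P (?x k)"
      and xx: "mixed_moment P (?x k) (?x k) = X k" and xv: "mixed_moment P (?x k) (v k) = 0" for k
  proof -
    show u_L2: "square_integrable P (?u k)"
      unfolding u by (intro square_integrable_add square_integrable_mult_vec x v k)
    then show "square_integrable P (?y k)"
      unfolding joint_def [abs_def] by (intro square_integrable_vcat x)
    have vx: "mixed_moment P (v k) (?x k) = 0"
      by (metis xv transpose_mixed_moment transpose_0)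
    have ux: "mixed_moment P (?u k) (?x k) = transpose (R k)"
      unfolding u
      by (simp add: mixed_moment_add_left mixed_moment_mult_left square_integrable_mult_vec
          x v k xx vx K)
    have xu: "mixed_moment P (?x k) (?u k) = R k"
      by (metis ux transpose_mixed_moment transpose_transpose)
    have "mixed_moment P (?u k) (v k) = U k - K k ** R k"
      unfolding u
      by (simp add: mixed_moment_add_left mixed_moment_mult_left square_integrable_mult_vec
          x v k xv vv)
    \<comment> \<open>Exchanging the arguments transposes the moment, and the Schur complement is
      symmetric.\<close>
    then have "mixed_moment P (v k) (?u k) = U k - K k ** R k"
      using pos_semidef_Schur_complement(2) [OF V [OF k] K [OF k]]
      by (metis pos_semidef_def transpose_mixed_moment)
    moreover have "mixed_moment P (\<lambda>\<omega>. K k *v ?x k \<omega> + v k \<omega>) (?u k) =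
        K k ** R k + mixed_moment P (v k) (?u k)"
      by (simp add: mixed_moment_add_left mixed_moment_mult_left square_integrable_mult_vec
          x v k u_L2 xu)
    ultimately have uu: "mixed_moment P (?u k) (?u k) = U k"
      by (simp flip: u)
    show "mixed_moment P (?y k) (?y k) = block (X k) (R k) (transpose (R k)) (U k)"
      unfolding joint_def [abs_def] mixed_moment_vcat xx xu ux uu ..
  qed
  \<comment> \<open>Orthogonality is claimed for all remaining \<open>v l\<close>: the case
    \<open>l = k\<close> yields the joint moment at time \<open>k\<close>, and the later ones keep
    the induction going.\<close>
  have x: "square_integrable P (?x k) \<and> mixed_moment P (?x k) (?x k) = X k \<and>
      (\<forall>l. k \<le> l \<and> l < N \<longrightarrow> mixed_moment P (?x k) (v l) = 0)" if "k < N" for k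
    using that
  proof (induction k)
    case 0
    have "?x 0 = (\<lambda>_. 0)" by (simp add: fun_eq_iff)
    then show ?case
      by (simp add: square_integrable_0 X0 vec_eq_iff mixed_moment_nth)
  next
    case (Suc k)
    then have k: "k < N" by simp
    from Suc have x: "square_integrable P (?x k)" "mixed_moment P (?x k) (?x k) = X k"
      and xv: "\<And>l. k \<le> l \<Longrightarrow> l < N \<Longrightarrow> mixed_moment P (?x k) (v l) = 0"
      by auto
    note yk = y [OF k x xv [OF order_refl k]]
    note xu = measurable_state [of N \<mu>, OF \<mu> less_imp_le [OF k]] x(1)
      measurable_input [of N \<mu>, OF \<mu> k] yk(1)
    have "square_integrable P (?x (Suc k))"
      unfolding state_Suc by (rule square_integrable_next_state [OF xu])
    moreover have "mixed_moment P (?x (Suc k)) (?x (Suc k)) = X (Suc k)"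
    proof -
      have "mixed_moment P (?x (Suc k)) (?x (Suc k)) =
          hcat A B ** mixed_moment P (?y k) (?y k) ** transpose (hcat A B)
          + (\<Sum>i\<in>{1..M}. Am i ** mixed_moment P (?x k) (?x k) ** transpose (Am i)) + mat 1"
        unfolding state_Suc joint_def [abs_def] by (rule mixed_moment_next_state [OF xu])
      then show ?thesis
        by (simp only: x(2) yk(3) X_Suc [OF Suc.prems])
    qed
    moreover have "mixed_moment P (?x (Suc k)) (v l) = 0" if l: "Suc k \<le> l" "l < N" for l
    proof -
      \<comment> \<open>Here \<open>l\<close> is strictly later than \<open>k\<close>, so
        \<open>v k\<close> and \<open>v l\<close> have zero mixed moment.\<close>
      have "mixed_moment P (?u k) (v l) = 0"
        unfolding u using l k
        by (simp add: mixed_moment_add_left mixed_moment_mult_left square_integrable_mult_vec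
            x v xv vv)
      moreover have "v l \<in> borel_measurable (info (past k))"
        by (rule measurable_info_v) (simp add: past_def)
      ultimately show ?thesis
        unfolding state_Suc using mixed_moment_next_state_past [OF xu _ v] l xv [of l] by simp
    qed
    ultimately show ?case by (intro conjI allI impI) (assumption | elim conjE)+
  qed
  show "square_integrable P (?y k)" "mixed_moment P (?y k) (?y k) = block (X k) (R k) (transpose (R k)) (U k)"
    using x [OF \<open>k < N\<close>] y [OF \<open>k < N\<close>] \<open>k < N\<close> by auto
qed

end

lemma measurable_linear_controller:
  fixes K :: "real^'n^'m" and k :: nat
  shows "(\<lambda>(h, r). K *v h k + r) \<in> borel_measurable (Pi\<^sub>M {..k} (\<lambda>_. borel) \<Otimes>\<^sub>M borel)"
proof -
  have "(\<lambda>p. fst p k) \<in> borel_measurable (Pi\<^sub>M {..k} (\<lambda>_. borel) \<Otimes>\<^sub>M (borel :: (real^'m) measure))"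
    by (rule measurable_compose [OF measurable_fst measurable_component_singleton]) simp
  from borel_measurable_add [OF measurable_mult_vec [OF this, of K] measurable_snd]
  show ?thesis
    by (simp add: case_prod_beta')
qed

section \<open>Optimality of the linear controller\<close>

text \<open>Stated outside the locale because a competing controller brings its own exogenous
  sequence, and so its own instance of \<open>noisy_system\<close>.\<close>

lemma finite_control_cost_attained_by_sdp:
  fixes A :: "real^'n^'n" and B :: "real^'m^'n"
  assumes "noise_model P w M \<sigma>" and cf: "control_feasible N P A B M Am w \<sigma> J Q \<gamma> \<mu> v"
    and cost: "control_cost N P A B M Am C D w \<sigma> \<mu> v < \<top>"
    and CD: "pos_def (transpose (hcat C D) ** hcat C D)" and N: "N > 0"
  obtains V where "sdp_feasible N A B M Am J Q \<gamma> V"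
    "control_cost N P A B M Am C D w \<sigma> \<mu> v = ennreal (sdp_objective N C D V)"
proof -
  have adm: "admissible N P w M \<sigma> \<mu> v"
    using cf by (simp add: control_feasible_def)
  interpret noisy_system P w M \<sigma> v
    using assms(1) adm by unfold_locales (simp_all add: admissible_def)
  note L2 = square_integrable_joint_of_finite_cost [OF adm cost CD]
  show ?thesis
    by (rule that [OF sdp_feasible_joint_moment [OF cf L2 N] control_cost_eq_sdp_objective [OF N L2]])
qed

text \<open>A second moment is always positive semidefinite, so the first conjunct certifies that
  \<open>\<Psi> k\<close> is a legitimate one. The sequence \<open>v\<close> is universally
  quantified because \<open>P\<close> need not carry any randomness beyond the noise.\<close>

theorem theorem5:
  fixes N M J :: nat
    and A :: "real^'n^'n" and B :: "real^'m^'n" and Am :: "nat \<Rightarrow> real^'n^'n"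
    and C :: "real^'n^'p" and D :: "real^'m^'p"
    and Q :: "nat \<Rightarrow> real^('n + 'm)^('n + 'm)" and \<gamma> :: "nat \<Rightarrow> nat \<Rightarrow> real"
    and P :: "'a measure"
    and w :: "nat \<Rightarrow> 'a \<Rightarrow> real^'n" and \<sigma> :: "nat \<Rightarrow> nat \<Rightarrow> 'a \<Rightarrow> real"
    and X :: "nat \<Rightarrow> real^'n^'n" and R :: "nat \<Rightarrow> real^'m^'n" and U :: "nat \<Rightarrow> real^'m^'m"
    and \<Psi> :: "nat \<Rightarrow> real^'m^'m"
  assumes "N > 0"
    and "pos_def (transpose (hcat C D) ** hcat C D)"
    and "\<And>j. j \<in> {1..J} \<Longrightarrow> transpose (Q j) = Q j"
    and "noise_model P w M \<sigma>"
    and "sdp_solution N A B M Am C D J Q \<gamma> (\<lambda>k. block (X k) (R k) (transpose (R k)) (U k))"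
    and "\<And>k. \<Psi> k = U k - transpose (R k) ** matrix_inv (X k) ** R k"
  shows "(\<forall>k<N. pos_semidef (\<Psi> k)) \<and>
    (\<forall>v :: nat \<Rightarrow> 'a \<Rightarrow> real^'m.
       exogenous P w M \<sigma> v \<and>
       (\<forall>k<N. square_integrable P (v k)) \<and>
       (\<forall>k<N. \<forall>l<N. mixed_moment P (v k) (v l) = (if k = l then \<Psi> k else 0)) \<longrightarrow>
       optimal_controller N P A B M Am C D w \<sigma> J Q \<gamma>
         (\<lambda>k x r. transpose (R k) ** matrix_inv (X k) *v x k + r) v)"
proof -
  define V where "V k = block (X k) (R k) (transpose (R k)) (U k)" for k
  define K where "K k = transpose (R k) ** matrix_inv (X k)" for k
  have feasible: "sdp_feasible N A B M Am J Q \<gamma> V"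
    and optimal: "\<And>V'. sdp_feasible N A B M Am J Q \<gamma> V' \<Longrightarrow>
      sdp_objective N C D V \<le> sdp_objective N C D V'"
    using assms(5) by (auto simp: sdp_solution_def V_def [abs_def])
  have V: "pos_semidef (V k)" if "k < N" for k
    using feasible that by (simp add: sdp_feasible_def)
  have F: "F_mat ** V k ** transpose F_mat = X k" for k
    by (simp add: V_def F_mat_block)
  have X0: "X 0 = 0"
    using feasible F [of 0] by (simp add: sdp_feasible_def)
  have Am: "Am i ** F_mat ** V k ** transpose F_mat ** transpose (Am i) =
      Am i ** X k ** transpose (Am i)" for i k
    by (simp flip: F add: matrix_mul_assoc)
  have X_Suc: "X (Suc k) = hcat A B ** V k ** transpose (hcat A B)
      + (\<Sum>i\<in>{1..M}. Am i ** X k ** transpose (Am i)) + mat 1" if "Suc k < N" for k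
    using feasible that F [of "Suc k"] by (simp add: sdp_feasible_def Am)
  have X_psd: "pos_semidef (X k)" if "k < N" for k
    using pos_semidef_congruence [OF V [OF that], of F_mat] by (simp add: F)
  \<comment> \<open>At positive times the recursion exhibits \<open>X k\<close> as a semidefinite
    matrix plus the identity; time 0 is the singular case.\<close>
  have inv: "X k = 0 \<or> invertible (X k)" if k: "k < N" for k
  proof (cases k)
    case (Suc l)
    then have "Suc l < N" "l < N" using k by auto
    then have "invertible (X (Suc l))"
      unfolding X_Suc [OF \<open>Suc l < N\<close>]
      by (intro invertible_pos_semidef_add_mat_1 pos_semidef_add pos_semidef_sum
          pos_semidef_congruence V X_psd)
    then show ?thesis using Suc by simp
  qed (simp add: X0)
  \<comment> \<open>The moment computation uses the gain only through this identity, which also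
    holds at time 0, where \<open>matrix_inv (X 0)\<close> is not a true inverse.\<close>
  have K: "K k ** X k = transpose (R k)" if "k < N" for k
    unfolding K_def using V [OF that] inv [OF that]
    unfolding V_def by (rule pos_semidef_block_gain)
  have \<Psi>: "\<Psi> k = U k - K k ** R k" for k
    unfolding assms(6) K_def ..
  have "pos_semidef (\<Psi> k)" if "k < N" for k
    unfolding \<Psi> by (rule pos_semidef_Schur_complement(2) [OF V [OF that, unfolded V_def] K [OF that]])
  moreover have "optimal_controller N P A B M Am C D w \<sigma> J Q \<gamma> (\<lambda>k x r. K k *v x k + r) v"
    if ex: "exogenous P w M \<sigma> v" and v: "\<forall>k<N. square_integrable P (v k)"
      and vv: "\<forall>k<N. \<forall>l<N. mixed_moment P (v k) (v l) = (if k = l then \<Psi> k else 0)" for v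
  proof -
    interpret noisy_system P w M \<sigma> v
      using assms(4) ex by unfold_locales
    let ?\<mu> = "\<lambda>k x r. K k *v x k + r"
    let ?y = "joint A B M Am w \<sigma> ?\<mu> v"
    have vv': "mixed_moment P (v k) (v l) = (if k = l then U k - K k ** R k else 0)"
      if "k < N" "l < N" for k l
      using vv that by (simp add: \<Psi>)
    have y: "square_integrable P (?y k)" "mixed_moment P (?y k) (?y k) = V k" if "k < N" for k
      by (rule joint_moment_linear_controller [of N X R U K A B Am, folded V_def,
            OF V K X0 X_Suc v [rule_format] vv' measurable_linear_controller that]; assumption)+
    have quadratic: "integrable P (\<lambda>\<omega>. ?y k \<omega> \<bullet> (Q j *v ?y k \<omega>))"
      "(\<integral>\<omega>. ?y k \<omega> \<bullet> (Q j *v ?y k \<omega>) \<partial>P) \<le> \<gamma> j k" if "j \<in> {1..J}" "k < N" for j k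
      using feasible that
      unfolding integral_quadratic_form(2) [OF y(1) [OF that(2)]] y(2) [OF that(2)]
      by (auto intro: integral_quadratic_form(1) y(1) simp: sdp_feasible_def)
    have "admissible N P w M \<sigma> ?\<mu> v"
      unfolding admissible_def by (intro conjI allI impI measurable_linear_controller ex)
    then have "control_feasible N P A B M Am w \<sigma> J Q \<gamma> ?\<mu> v"
      unfolding control_feasible_iff_joint by (intro conjI ballI allI impI quadratic)
    moreover have "control_cost N P A B M Am C D w \<sigma> ?\<mu> v \<le> control_cost N P A B M Am C D w \<sigma> \<mu>' v'"
      if cf: "control_feasible N P A B M Am w \<sigma> J Q \<gamma> \<mu>' v'" for \<mu>' v'
    proof (cases "control_cost N P A B M Am C D w \<sigma> \<mu>' v' < \<top>")
      \<comment> \<open>A finite competing cost is the objective at some feasible point, so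
        minimality of \<open>V\<close> applies; an infinite one needs no comparison.\<close>
      case True
      obtain V' where V': "sdp_feasible N A B M Am J Q \<gamma> V'"
          "control_cost N P A B M Am C D w \<sigma> \<mu>' v' = ennreal (sdp_objective N C D V')"
        by (rule finite_control_cost_attained_by_sdp [OF assms(4) cf True assms(2,1)])
      have "control_cost N P A B M Am C D w \<sigma> ?\<mu> v = ennreal (sdp_objective N C D V)"
        by (subst control_cost_eq_sdp_objective [OF assms(1) y(1)]) (simp_all add: sdp_objective_def y(2))
      also have "\<dots> \<le> control_cost N P A B M Am C D w \<sigma> \<mu>' v'"
        unfolding V'(2) by (intro ennreal_leI optimal V'(1))
      finally show ?thesis .
    next
      case False
      then show ?thesis by (simp add: not_less top_unique)
    qed
    ultimately show ?thesis
      by (simp add: optimal_controller_def)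
  qed
  ultimately show ?thesis
    by (simp add: K_def)
qed

end
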